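(* For every superscheme $S$ with $R=\Gamma(S,\mathcal O_S)$, the map sending a superconformal automorphism $(z|\zeta)\mapsto(\hat z|\hat\zeta)=(u+\zeta\omega\,|\,\eta+\zeta v)$ to the pair $(u+\zeta\eta,\,v)$ is a bijection, natural in $S$, $$\psi_S:\mathrm{SWitt}(S)\xrightarrow{\sim}\widetilde{\Gamma^1_{0/2}}(S):=\{(u+\zeta\eta,\,v)\in\Gamma^1_{0/2}(S)\times R_0((z)) : v^2=u'+\eta\eta'\},$$ where $u\in R_0((z))$, $\eta\in R_1((z))$ and $'$ denotes $d/dz$.
   Context: $z$ even, $\zeta$ odd. $\Gamma^1_{0/2}(S)$ is the set of even elements $\sum_{n\ge-M}(a_n+\alpha_n\zeta)z^n$ of $R((z))[\zeta]$ ($a_n\in R_0,\alpha_n\in R_1$, some $M$) with $a_1\in R_0^\times$ and $a_n$ nilpotent for all $n<1$. $\mathrm{SWitt}(S)$ is the set of $R$-algebra automorphisms $\phi$ of $R((z))[\zeta]$ that are homeomorphisms for the $z$-adic topology (continuity: for each $M$ there is $N$ with $\phi(z^N R[[z]][\zeta])\subset z^MR[[z]][\zeta]$) and are superconformal: $\phi^*D_\zeta=FD_\zeta$ for some $F$, where $D_\zeta=\partial_\zeta+\zeta\partial_z$. Such $\phi$ is determined by $\hat z=\phi(z)=u(z)+\zeta\omega(z)$ and $\hat\zeta=\phi(\zeta)=\eta(z)+\zeta v(z)$, and superconformality is equivalent to $D_\zeta\hat z=\hat\zeta D_\zeta\hat\zeta$, i.e.\ $\omega=\eta v$ and $u'=v^2-\eta\eta'$.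 *)

theory Defs
  imports "HOL-Computational_Algebra.Formal_Laurent_Series"
begin

unbundle fps_syntax

text \<open>A supercommutative ring R = R_0 + R_1 is modelled as a type 'a of class ring_1
  (the whole ring R) together with its even part R0 = R_0 and odd part R1 = R_1.\<close>

definition superring :: "'a::ring_1 set \<Rightarrow> 'a set \<Rightarrow> bool" where
  "superring R0 R1 \<longleftrightarrow>
     0 \<in> R0 \<and> 0 \<in> R1 \<and> 1 \<in> R0 \<and>
     (\<forall>x\<in>R0. \<forall>y\<in>R0. x + y \<in> R0 \<and> - x \<in> R0 \<and> x * y \<in> R0) \<and>
     (\<forall>x\<in>R1. \<forall>y\<in>R1. x + y \<in> R1 \<and> - x \<in> R1 \<and> x * y \<in> R0) \<and>
     (\<forall>x\<in>R0. \<forall>y\<in>R1. x * y \<in> R1 \<and> y * x \<in> R1) \<and>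
     R0 \<inter> R1 = {0} \<and> (\<forall>x. \<exists>a\<in>R0. \<exists>b\<in>R1. x = a + b) \<and>
     (\<forall>a\<in>R0. \<forall>x. a * x = x * a) \<and>
     (\<forall>a\<in>R1. \<forall>b\<in>R1. a * b = - (b * a)) \<and>
     (\<forall>a\<in>R1. a * a = 0)"

text \<open>Morphisms of supercommutative rings (even unital ring homomorphisms); these are
  exactly the maps Gamma(S,O_S) -> Gamma(S',O_S') induced by morphisms S' -> S.\<close>
definition superring_hom :: "'a::ring_1 set \<Rightarrow> 'a set \<Rightarrow> 'b::ring_1 set \<Rightarrow> 'b set \<Rightarrow> ('a \<Rightarrow> 'b) \<Rightarrow> bool" where
  "superring_hom R0 R1 R0' R1' h \<longleftrightarrow>
     h 1 = 1 \<and> (\<forall>x y. h (x + y) = h x + h y) \<and> (\<forall>x y. h (x * y) = h x * h y) \<and>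
     h ` R0 \<subseteq> R0' \<and> h ` R1 \<subseteq> R1'"

definition evpart :: "'a::ring_1 set \<Rightarrow> 'a set \<Rightarrow> 'a \<Rightarrow> 'a" where
  "evpart R0 R1 a = (THE e. e \<in> R0 \<and> a - e \<in> R1)"

definition parinv :: "'a::ring_1 set \<Rightarrow> 'a set \<Rightarrow> 'a \<Rightarrow> 'a" where
  "parinv R0 R1 a = evpart R0 R1 a - (a - evpart R0 R1 a)"

definition fls_map :: "('a::zero \<Rightarrow> 'b::zero) \<Rightarrow> 'a fls \<Rightarrow> 'b fls" where
  "fls_map h f = Abs_fls (\<lambda>n. h (f $$ n))"

text \<open>An element f + zeta g (zeta written on the left, f, g in R((z))) is the pair (f, g).
  Since zeta is odd, a zeta = zeta (parinv a) for a in R, and zeta^2 = 0, so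
  (f + zeta g)(h + zeta k) = f h + zeta (parinv(f) k + g h).\<close>

type_synonym 'a sls = "'a fls \<times> 'a fls"

definition sadd :: "'a::ring_1 sls \<Rightarrow> 'a sls \<Rightarrow> 'a sls" where
  "sadd x y = (fst x + fst y, snd x + snd y)"

definition smult :: "'a::ring_1 set \<Rightarrow> 'a set \<Rightarrow> 'a sls \<Rightarrow> 'a sls \<Rightarrow> 'a sls" where
  "smult R0 R1 x y = (fst x * fst y, fls_map (parinv R0 R1) (fst x) * snd y + snd x * fst y)"

definition sconst :: "'a::ring_1 \<Rightarrow> 'a sls" where
  "sconst c = (fls_const c, 0)"

definition sz :: "'a::ring_1 sls" where "sz = (fls_X, 0)"
definition szeta :: "'a::ring_1 sls" where "szeta = (0, 1)"

definition seven :: "'a::ring_1 set \<Rightarrow> 'a set \<Rightarrow> 'a sls \<Rightarrow> bool" where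
  "seven R0 R1 x \<longleftrightarrow> (\<forall>n. fst x $$ n \<in> R0) \<and> (\<forall>n. snd x $$ n \<in> R1)"

definition sodd :: "'a::ring_1 set \<Rightarrow> 'a set \<Rightarrow> 'a sls \<Rightarrow> bool" where
  "sodd R0 R1 x \<longleftrightarrow> (\<forall>n. fst x $$ n \<in> R1) \<and> (\<forall>n. snd x $$ n \<in> R0)"

text \<open>D_zeta = d/dzeta + zeta d/dz :  f + zeta g |-> g + zeta f'.\<close>
definition sD :: "'a::ring_1 sls \<Rightarrow> 'a sls" where
  "sD x = (snd x, fls_deriv (fst x))"

definition zadic :: "int \<Rightarrow> 'a::ring_1 sls set" where
  "zadic N = {x. \<forall>n<N. fst x $$ n = 0 \<and> snd x $$ n = 0}"

definition zcont :: "('a::ring_1 sls \<Rightarrow> 'a sls) \<Rightarrow> bool" where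
  "zcont \<phi> \<longleftrightarrow> (\<forall>M. \<exists>N. \<phi> ` zadic N \<subseteq> zadic M)"

definition SWitt :: "'a::ring_1 set \<Rightarrow> 'a set \<Rightarrow> ('a sls \<Rightarrow> 'a sls) set" where
  "SWitt R0 R1 = {\<phi>. bij \<phi> \<and>
      (\<forall>x y. \<phi> (sadd x y) = sadd (\<phi> x) (\<phi> y)) \<and>
      (\<forall>x y. \<phi> (smult R0 R1 x y) = smult R0 R1 (\<phi> x) (\<phi> y)) \<and>
      (\<forall>c. \<phi> (sconst c) = sconst c) \<and>
      (\<forall>x. seven R0 R1 x \<longrightarrow> seven R0 R1 (\<phi> x)) \<and>
      (\<forall>x. sodd R0 R1 x \<longrightarrow> sodd R0 R1 (\<phi> x)) \<and>
      zcont \<phi> \<and> zcont (inv \<phi>) \<and>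
      (\<exists>F. \<forall>x. inv \<phi> (sD (\<phi> x)) = smult R0 R1 F (sD x))}"

definition Gamma1 :: "'a::ring_1 set \<Rightarrow> 'a set \<Rightarrow> 'a sls set" where
  "Gamma1 R0 R1 = {x. seven R0 R1 x \<and>
      (\<exists>b\<in>R0. fst x $$ 1 * b = 1 \<and> b * fst x $$ 1 = 1) \<and>
      (\<forall>n<1. \<exists>k::nat. (fst x $$ n) ^ k = 0)}"

definition GammaT :: "'a::ring_1 set \<Rightarrow> 'a set \<Rightarrow> ('a sls \<times> 'a fls) set" where
  "GammaT R0 R1 = {(x, v). x \<in> Gamma1 R0 R1 \<and> (\<forall>n. v $$ n \<in> R0) \<and>
      v ^ 2 = fls_deriv (fst x) + snd x * fls_deriv (snd x)}"

definition psi :: "('a::ring_1 sls \<Rightarrow> 'a sls) \<Rightarrow> 'a sls \<times> 'a fls" where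
  "psi \<phi> = ((fst (\<phi> sz), fst (\<phi> szeta)), snd (\<phi> szeta))"

definition smap :: "('a::ring_1 \<Rightarrow> 'b::ring_1) \<Rightarrow> 'a sls \<Rightarrow> 'b sls" where
  "smap h x = (fls_map h (fst x), fls_map h (snd x))"

definition tmap :: "('a::ring_1 \<Rightarrow> 'b::ring_1) \<Rightarrow> 'a sls \<times> 'a fls \<Rightarrow> 'b sls \<times> 'b fls" where
  "tmap h p = (smap h (fst p), fls_map h (snd p))"

end

(* The pair (u + zeta eta, v) determines the images of z and zeta, since omega = eta v; by continuity
   it determines the automorphism. Conversely such a pair gives
     phi (f + zeta g) = (f(u) + eta g(u)) + zeta v (eta f'(u) + g(u)),
   and the point is that f |-> f(u) makes sense and is invertible although u has nilpotent coefficients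
   in degrees n < 1. For this, z^m I^k is given weight m + k W, where I is the nilpotent ideal generated
   by those coefficients and W exceeds the pole order: for the resulting filtration u = a_1 z modulo
   higher weight, so f |-> f(u) is a perturbation of the bijection f |-> f(a_1 z), and the filtration
   is complete. The same argument inverts u, and also v, because z v^2 = z (u' + eta eta') has the
   same shape as u.

   That an automorphism has a_1 invertible and a_n nilpotent for n < 1 follows from continuity: the
   powers of u tend to 0, so its lowest coefficient in degree < 1 is nilpotent and can be peeled off,
   and likewise for the inverse. Comparing coefficients of z in z = phi (phi^-1 z) modulo nilpotents
   then shows that a_1 is a unit. *)

theory Submission
  imports Defs
begin

section \<open>Continuous additive maps of Laurent series\<close>

text \<open>The z-adic filtration alone does not work: multiplication by \<open>u\<close> can lower
  degrees, so \<open>u\<close> is not a small perturbation of a_1 z for it. Weights stay comparable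
  with degrees because the ideal has some nilpotency index L: a coefficient of weight C = W L or
  more is 0, so a series of weight n has no terms in degree n - C or below. This loss C is the same
  for all integral powers of \<open>u\<close>; it makes f(u) a finite sum in each degree, gives
  completeness, and makes the inverse substitution continuous. That L exists rests on finiteness:
  only finitely many degrees below 1 carry coefficients of \<open>u\<close>, whereas infinitely many
  nilpotents need not generate a nilpotent ideal. For this reason the odd coefficients of \<eta> are
  kept out of the ideal, and \<eta> is handled through \<eta>^2 = 0 instead. Multiplication by
  \<eta> does not commute with odd scalars, so maps are treated as additive and continuous only, and
  identities are tested on monomials c z^n with the scalar c kept inside.\<close>

definition fls_above :: "int \<Rightarrow> 'a::zero fls set" where
  "fls_above N = {f. \<forall>n<N. f $$ n = 0}"

definition fls_monom :: "'a::zero \<Rightarrow> int \<Rightarrow> 'a fls" where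
  "fls_monom c n = fls_shift (- n) (fls_const c)"

lemma fls_aboveD: "f \<in> fls_above N \<Longrightarrow> n < N \<Longrightarrow> f $$ n = 0"
  by (simp add: fls_above_def)

lemma fls_aboveI: "(\<And>n. n < N \<Longrightarrow> f $$ n = 0) \<Longrightarrow> f \<in> fls_above N"
  by (simp add: fls_above_def)

lemma fls_above_subdegree: "f \<in> fls_above (fls_subdegree f)"
  by (simp add: fls_above_def)

lemma fls_above_mono: "f \<in> fls_above N \<Longrightarrow> M \<le> N \<Longrightarrow> f \<in> fls_above M"
  by (simp add: fls_above_def)

lemma fls_monom_nth [simp]: "fls_monom c n $$ m = (if m = n then c else 0)"
  by (simp add: fls_monom_def)

lemma fls_monom_above: "fls_monom c n \<in> fls_above n"
  by (simp add: fls_above_def)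

lemma fls_const_conv_monom: "fls_const c = fls_monom c 0"
  by (rule fls_eqI) simp

lemma fls_X_conv_monom: "fls_X = fls_monom 1 1"
  by (rule fls_eqI) simp

lemma fls_one_conv_monom: "1 = fls_monom 1 0"
  by (rule fls_eqI) simp

text \<open>Any lower bounds may replace the exact subdegrees, so sums for different series can
  share one index range.\<close>

lemma fls_times_nth_above:
  fixes f g :: "'a::ring_1 fls"
  assumes f: "f \<in> fls_above a" and g: "g \<in> fls_above b"
  shows "(f * g) $$ n = (\<Sum>i=a..n - b. f $$ i * g $$ (n - i))"
proof -
  let ?df = "fls_subdegree f" and ?dg = "fls_subdegree g"
  let ?U = "{min a ?df..max (n - b) (n - ?dg)}"
  have "(f * g) $$ n = (\<Sum>i=?df..n - ?dg. f $$ i * g $$ (n - i))"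
    by (rule fls_times_nth(2))
  also have "\<dots> = (\<Sum>i\<in>?U. f $$ i * g $$ (n - i))"
  proof (rule sum.mono_neutral_left)
    show "\<forall>i\<in>?U - {?df..n - ?dg}. f $$ i * g $$ (n - i) = 0"
    proof
      fix i assume "i \<in> ?U - {?df..n - ?dg}"
      then have "i < ?df \<or> n - i < ?dg" by auto
      then show "f $$ i * g $$ (n - i) = 0" by auto
    qed
  qed auto
  also have "\<dots> = (\<Sum>i=a..n - b. f $$ i * g $$ (n - i))"
  proof (rule sum.mono_neutral_right)
    show "\<forall>i\<in>?U - {a..n - b}. f $$ i * g $$ (n - i) = 0"
    proof
      fix i assume "i \<in> ?U - {a..n - b}"
      then have "i < a \<or> n - i < b" by auto
      then show "f $$ i * g $$ (n - i) = 0" using fls_aboveD[OF f] fls_aboveD[OF g] by auto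
    qed
  qed auto
  finally show ?thesis .
qed

lemma fls_above_mult:
  fixes f g :: "'a::ring_1 fls"
  assumes "f \<in> fls_above a" "g \<in> fls_above b"
  shows "f * g \<in> fls_above (a + b)"
  by (rule fls_aboveI) (simp add: fls_times_nth_above[OF assms])

lemma fls_above_add:
  fixes f g :: "'a::ring_1 fls"
  shows "f \<in> fls_above a \<Longrightarrow> g \<in> fls_above a \<Longrightarrow> f + g \<in> fls_above a"
  by (simp add: fls_above_def)

lemma fls_above_diff:
  fixes f g :: "'a::ring_1 fls"
  shows "f \<in> fls_above a \<Longrightarrow> g \<in> fls_above a \<Longrightarrow> f - g \<in> fls_above a"
  by (simp add: fls_above_def)

lemma fls_eq_zero_above:
  assumes "\<And>M. \<exists>N\<ge>M. f \<in> fls_above N"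
  shows "f = 0"
proof (rule fls_zero_eqI)
  fix n
  obtain N where "N \<ge> n + 1" "f \<in> fls_above N" using assms by blast
  then show "f $$ n = 0" by (simp add: fls_above_def)
qed

lemma fls_monom_times_nth [simp]:
  fixes f :: "'a::ring_1 fls"
  shows "(fls_monom c k * f) $$ n = c * f $$ (n - k)"
    and "(f * fls_monom c k) $$ n = f $$ (n - k) * c"
  by (simp_all add: fls_monom_def fls_shifted_times_simps)

lemma fls_monom_mult_monom [simp]:
  fixes c d :: "'a::ring_1"
  shows "fls_monom c k * fls_monom d l = fls_monom (c * d) (k + l)"
  by (rule fls_eqI) auto

lemma fls_deriv_monom:
  fixes c :: "'a::ring_1"
  shows "fls_deriv (fls_monom c k) = fls_monom (of_int k * c) (k - 1)"
  by (rule fls_eqI) auto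

lemma fls_diff_partial_sum_above:
  fixes f :: "'a::ring_1 fls"
  assumes "f \<in> fls_above lo"
  shows "f - (\<Sum>n\<in>{lo..<H}. fls_monom (f $$ n) n) \<in> fls_above H"
proof (rule fls_aboveI)
  fix n assume "n < H"
  then show "(f - (\<Sum>n\<in>{lo..<H}. fls_monom (f $$ n) n)) $$ n = 0"
    using fls_aboveD[OF assms, of n] by (auto simp: fls_nth_sum)
qed

lemma fls_map_nth:
  assumes "h 0 = 0"
  shows "fls_map h f $$ n = h (f $$ n)"
  unfolding fls_map_def
proof (rule nth_Abs_fls_ex_lower_bound)
  show "\<exists>N. \<forall>n<N. h (f $$ n) = 0"
    using assms by (metis fls_eq0_below_subdegree)
qed

text \<open>Linearity over the ring would be too strong: \<open>Par\<close> and left multiplication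
  by an odd series are not left linear. For additive maps, continuity at 0 is continuity.\<close>

definition fls_contadd :: "('a::ring_1 fls \<Rightarrow> 'b::ring_1 fls) \<Rightarrow> bool" where
  "fls_contadd A \<longleftrightarrow> (\<forall>f g. A (f + g) = A f + A g) \<and>
     (\<forall>M. \<exists>N. \<forall>f\<in>fls_above N. A f \<in> fls_above M)"

lemma fls_contadd_plus: "fls_contadd A \<Longrightarrow> A (f + g) = A f + A g"
  by (simp add: fls_contadd_def)

lemma fls_contadd_0: "fls_contadd A \<Longrightarrow> A 0 = 0"
  using fls_contadd_plus[of A 0 0] by simp

lemma fls_contadd_minus: "fls_contadd A \<Longrightarrow> A (f - g) = A f - A g"
  using fls_contadd_plus[of A "f - g" g] by simp

lemma fls_contadd_sum: "fls_contadd A \<Longrightarrow> A (\<Sum>i\<in>S. f i) = (\<Sum>i\<in>S. A (f i))"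
  by (induction S rule: infinite_finite_induct) (simp_all add: fls_contadd_0 fls_contadd_plus)

lemma fls_contadd_id: "fls_contadd (\<lambda>f. f)"
  by (auto simp: fls_contadd_def)

lemma fls_contadd_add:
  assumes "fls_contadd A" "fls_contadd B"
  shows "fls_contadd (\<lambda>f. A f + B f)"
  unfolding fls_contadd_def
proof (intro conjI allI)
  fix M
  obtain N1 N2 where "\<forall>f\<in>fls_above N1. A f \<in> fls_above M" "\<forall>f\<in>fls_above N2. B f \<in> fls_above M"
    using assms unfolding fls_contadd_def by metis
  then have "\<forall>f\<in>fls_above (max N1 N2). A f + B f \<in> fls_above M"
    by (metis fls_above_add fls_above_mono max.cobounded1 max.cobounded2)
  then show "\<exists>N. \<forall>f\<in>fls_above N. A f + B f \<in> fls_above M" by blast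
qed (use assms in \<open>simp add: fls_contadd_plus\<close>)

lemma fls_contadd_comp:
  assumes "fls_contadd A" "fls_contadd B"
  shows "fls_contadd (\<lambda>f. A (B f))"
  unfolding fls_contadd_def
proof (intro conjI allI)
  fix M
  obtain N1 where "\<forall>f\<in>fls_above N1. A f \<in> fls_above M"
    using assms unfolding fls_contadd_def by metis
  moreover obtain N2 where "\<forall>f\<in>fls_above N2. B f \<in> fls_above N1"
    using assms unfolding fls_contadd_def by metis
  ultimately show "\<exists>N. \<forall>f\<in>fls_above N. A (B f) \<in> fls_above M" by blast
qed (use assms in \<open>simp add: fls_contadd_plus\<close>)

lemma fls_contadd_lmult:
  assumes "fls_contadd A"
  shows "fls_contadd (\<lambda>f. h * A f)"
proof -
  have "fls_contadd (\<lambda>f. h * f)"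
    unfolding fls_contadd_def
  proof (intro conjI allI)
    fix M
    have "\<forall>f\<in>fls_above (M - fls_subdegree h). h * f \<in> fls_above M"
      using fls_above_mult[OF fls_above_subdegree[of h]] by fastforce
    then show "\<exists>N. \<forall>f\<in>fls_above N. h * f \<in> fls_above M" by blast
  qed (simp add: distrib_left)
  then show ?thesis using assms by (rule fls_contadd_comp)
qed

lemma fls_contadd_rmult:
  assumes "fls_contadd A"
  shows "fls_contadd (\<lambda>f. A f * h)"
proof -
  have "fls_contadd (\<lambda>f. f * h)"
    unfolding fls_contadd_def
  proof (intro conjI allI)
    fix M
    have "\<forall>f\<in>fls_above (M - fls_subdegree h). f * h \<in> fls_above M"
      using fls_above_mult[OF _ fls_above_subdegree[of h]] by fastforce
    then show "\<exists>N. \<forall>f\<in>fls_above N. f * h \<in> fls_above M" by blast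
  qed (simp add: distrib_right)
  then show ?thesis using assms by (rule fls_contadd_comp)
qed

lemma fls_contadd_diff:
  assumes "fls_contadd A" "fls_contadd B"
  shows "fls_contadd (\<lambda>f. A f - B f)"
  using fls_contadd_add[OF assms(1) fls_contadd_lmult[OF assms(2), of "-1"]] by simp

lemma fls_contadd_deriv:
  assumes "fls_contadd A"
  shows "fls_contadd (\<lambda>f. fls_deriv (A f))"
proof -
  have "fls_contadd fls_deriv"
    unfolding fls_contadd_def
  proof (intro conjI allI)
    fix M :: int
    have "\<forall>f\<in>fls_above (M + 1). fls_deriv f \<in> fls_above M"
      by (auto simp: fls_above_def)
    then show "\<exists>N. \<forall>f\<in>fls_above N. fls_deriv f \<in> fls_above M" by blast
  qed simp
  then show ?thesis using assms by (rule fls_contadd_comp)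
qed

lemma fls_contadd_map:
  assumes "fls_contadd A" "\<And>x y. h (x + y) = h x + h y"
  shows "fls_contadd (\<lambda>f. fls_map h (A f))"
proof -
  have h0: "h 0 = 0" using assms(2)[of 0 0] by simp
  have "fls_contadd (fls_map h)"
    unfolding fls_contadd_def
  proof (intro conjI allI)
    fix M :: int
    have "\<forall>f\<in>fls_above M. fls_map h f \<in> fls_above M"
      by (auto simp: fls_above_def fls_map_nth h0)
    then show "\<exists>N. \<forall>f\<in>fls_above N. fls_map h f \<in> fls_above M" by blast
  qed (simp add: fls_eq_iff fls_map_nth h0 assms(2))
  then show ?thesis using assms(1) by (rule fls_contadd_comp)
qed

lemmas fls_contadd_intros = fls_contadd_id fls_contadd_add fls_contadd_diff fls_contadd_lmult
  fls_contadd_rmult fls_contadd_deriv fls_contadd_map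

lemma fls_contadd_nth:
  assumes "fls_contadd A"
  obtains H where "\<And>lo f. f \<in> fls_above lo \<Longrightarrow>
    A f $$ m = (\<Sum>n\<in>{lo..<H}. A (fls_monom (f $$ n) n) $$ m)"
proof -
  obtain H where H: "\<And>f. f \<in> fls_above H \<Longrightarrow> A f \<in> fls_above (m + 1)"
    using assms unfolding fls_contadd_def by metis
  have "A f $$ m = (\<Sum>n\<in>{lo..<H}. A (fls_monom (f $$ n) n) $$ m)" if "f \<in> fls_above lo" for lo f
  proof -
    have "A (f - (\<Sum>n\<in>{lo..<H}. fls_monom (f $$ n) n)) $$ m = 0"
      using H[OF fls_diff_partial_sum_above[OF that]] by (simp add: fls_above_def)
    then show ?thesis
      by (simp add: fls_contadd_minus[OF assms] fls_contadd_sum[OF assms] fls_nth_sum)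
  qed
  then show ?thesis by (rule that)
qed

text \<open>Continuity reduces every identity between additive maps to monomials.\<close>

lemma fls_contadd_eqI:
  assumes "fls_contadd A" "fls_contadd B" "\<And>c n. A (fls_monom c n) = B (fls_monom c n)"
  shows "A f = B f"
proof (rule fls_eqI)
  fix m
  let ?C = "\<lambda>f. A f - B f"
  have "fls_contadd ?C" using assms(1,2) by (rule fls_contadd_diff)
  then obtain H where "\<And>lo f. f \<in> fls_above lo \<Longrightarrow>
      ?C f $$ m = (\<Sum>n\<in>{lo..<H}. ?C (fls_monom (f $$ n) n) $$ m)"
    using fls_contadd_nth by blast
  from this[OF fls_above_subdegree[of f]] show "A f $$ m = B f $$ m"
    by (simp add: assms(3))
qed

lemma fls_contadd2_eqI:
  assumes "\<And>g. fls_contadd (\<lambda>f. A f g)" "\<And>f. fls_contadd (A f)"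
    and "\<And>g. fls_contadd (\<lambda>f. B f g)" "\<And>f. fls_contadd (B f)"
    and "\<And>c n d m. A (fls_monom c n) (fls_monom d m) = B (fls_monom c n) (fls_monom d m)"
  shows "A f g = B f g"
proof (rule fls_contadd_eqI[OF assms(1) assms(3)])
  show "A (fls_monom c n) g = B (fls_monom c n) g" for c n
    by (rule fls_contadd_eqI[OF assms(2) assms(4) assms(5)])
qed

section \<open>Laurent series over a supercommutative ring\<close>

locale supercommutative_ring =
  fixes R0 R1 :: "'a::ring_1 set"
  assumes superring: "superring R0 R1"
begin

lemma R0_0 [simp]: "0 \<in> R0" and R1_0 [simp]: "0 \<in> R1" and R0_1 [simp]: "1 \<in> R0"
  using superring unfolding superring_def by metis+

lemma R0_add: "x \<in> R0 \<Longrightarrow> y \<in> R0 \<Longrightarrow> x + y \<in> R0"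
  and R0_uminus: "x \<in> R0 \<Longrightarrow> - x \<in> R0"
  and R0_mult: "x \<in> R0 \<Longrightarrow> y \<in> R0 \<Longrightarrow> x * y \<in> R0"
  and R1_add: "x \<in> R1 \<Longrightarrow> y \<in> R1 \<Longrightarrow> x + y \<in> R1"
  and R1_uminus: "x \<in> R1 \<Longrightarrow> - x \<in> R1"
  and R11_mult: "x \<in> R1 \<Longrightarrow> y \<in> R1 \<Longrightarrow> x * y \<in> R0"
  and R01_mult: "x \<in> R0 \<Longrightarrow> y \<in> R1 \<Longrightarrow> x * y \<in> R1"
  and R10_mult: "x \<in> R1 \<Longrightarrow> y \<in> R0 \<Longrightarrow> x * y \<in> R1"
  and R0_central: "x \<in> R0 \<Longrightarrow> x * z = z * x"
  and R1_anticommute: "x \<in> R1 \<Longrightarrow> y \<in> R1 \<Longrightarrow> x * y = - (y * x)"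
  and R1_square: "x \<in> R1 \<Longrightarrow> x * x = 0"
  using superring unfolding superring_def by metis+

lemma R0_Int_R1: "x \<in> R0 \<Longrightarrow> x \<in> R1 \<Longrightarrow> x = 0"
  using superring unfolding superring_def by blast

lemma decompose_R: obtains a b where "a \<in> R0" "b \<in> R1" "x = a + b"
  using superring unfolding superring_def by metis

lemma R0_diff: "x \<in> R0 \<Longrightarrow> y \<in> R0 \<Longrightarrow> x - y \<in> R0"
  using R0_add[OF _ R0_uminus] by fastforce

lemma R1_diff: "x \<in> R1 \<Longrightarrow> y \<in> R1 \<Longrightarrow> x - y \<in> R1"
  using R1_add[OF _ R1_uminus] by fastforce

lemma R0_power: "x \<in> R0 \<Longrightarrow> x ^ n \<in> R0"
  by (induction n) (simp_all add: R0_mult)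

lemma R0_sum: "(\<And>i. i \<in> S \<Longrightarrow> f i \<in> R0) \<Longrightarrow> sum f S \<in> R0"
  by (induction S rule: infinite_finite_induct) (simp_all add: R0_add)

lemma R1_sum: "(\<And>i. i \<in> S \<Longrightarrow> f i \<in> R1) \<Longrightarrow> sum f S \<in> R1"
  by (induction S rule: infinite_finite_induct) (simp_all add: R1_add)

lemma R0_of_int: "of_int n \<in> R0"
proof -
  have "of_nat k \<in> R0" for k by (induction k) (simp_all add: R0_add)
  then show ?thesis by (cases n) (simp_all add: R0_uminus R0_diff)
qed

abbreviation ev :: "'a \<Rightarrow> 'a" where "ev \<equiv> evpart R0 R1"
abbreviation par :: "'a \<Rightarrow> 'a" where "par \<equiv> parinv R0 R1"

lemma ev_eq: "a \<in> R0 \<Longrightarrow> b \<in> R1 \<Longrightarrow> ev (a + b) = a"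
  unfolding evpart_def
proof (rule the_equality)
  fix e assume "a \<in> R0" "b \<in> R1" "e \<in> R0 \<and> a + b - e \<in> R1"
  then have "e - a \<in> R0" "b - (a + b - e) \<in> R1" by (blast intro: R0_diff R1_diff)+
  then show "e = a" using R0_Int_R1[of "e - a"] by simp
qed simp

lemma par_eq: "a \<in> R0 \<Longrightarrow> b \<in> R1 \<Longrightarrow> par (a + b) = a - b"
  by (simp add: parinv_def ev_eq)

lemma ev_R0: "a \<in> R0 \<Longrightarrow> ev a = a"
  using ev_eq[of a 0] by simp

lemma ev_in_R0: "ev x \<in> R0"
  by (rule decompose_R[of x]) (simp add: ev_eq)

lemma diff_ev_in_R1: "x - ev x \<in> R1"
  by (rule decompose_R[of x]) (simp add: ev_eq)

lemma ev_add: "ev (x + y) = ev x + ev y"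
proof -
  obtain a b c d where *: "a \<in> R0" "b \<in> R1" "x = a + b" "c \<in> R0" "d \<in> R1" "y = c + d"
    using decompose_R by metis
  have "x + y = (a + c) + (b + d)" using * by (simp add: algebra_simps)
  then have "ev (x + y) = a + c" using * by (simp only: ev_eq R0_add R1_add)
  then show ?thesis using * by (simp add: ev_eq)
qed

lemma ev_mult_R0:
  assumes "a \<in> R0"
  shows "ev (a * x) = a * ev x"
  by (rule decompose_R[of x]) (simp add: ev_eq distrib_left R0_mult R01_mult assms)

lemma par_R0: "a \<in> R0 \<Longrightarrow> par a = a"
  using par_eq[of a 0] by simp

lemma par_R1: "a \<in> R1 \<Longrightarrow> par a = - a"
  using par_eq[of 0 a] by simp

lemma par_0 [simp]: "par 0 = 0"
  by (simp add: par_R0)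

lemma par_add: "par (x + y) = par x + par y"
  by (simp add: parinv_def ev_add)

lemma par_mult: "par (x * y) = par x * par y"
proof -
  obtain a b c d where *: "a \<in> R0" "b \<in> R1" "x = a + b" "c \<in> R0" "d \<in> R1" "y = c + d"
    using decompose_R by metis
  have "x * y = (a * c + b * d) + (a * d + b * c)" using * by (simp add: algebra_simps)
  moreover have "par \<dots> = (a * c + b * d) - (a * d + b * c)"
    using * by (blast intro: par_eq R0_add R1_add R0_mult R11_mult R01_mult R10_mult)
  moreover have "\<dots> = (a - b) * (c - d)" by (simp add: algebra_simps)
  moreover have "par x * par y = (a - b) * (c - d)" using * by (simp add: par_eq)
  ultimately show ?thesis by metis
qed

lemma R1_mult_commute:
  assumes "r \<in> R1"
  shows "x * r = r * par x"
proof -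
  obtain a b where *: "a \<in> R0" "b \<in> R1" "x = a + b" by (rule decompose_R)
  show ?thesis
    using * R0_central[of a r] R1_anticommute[of b r] assms by (simp add: par_eq algebra_simps)
qed

definition E0 :: "'a fls set" where "E0 = {f. \<forall>n. f $$ n \<in> R0}"
definition E1 :: "'a fls set" where "E1 = {f. \<forall>n. f $$ n \<in> R1}"

abbreviation Par :: "'a fls \<Rightarrow> 'a fls" where "Par \<equiv> fls_map par"

lemma Par_nth [simp]: "Par f $$ n = par (f $$ n)"
  by (rule fls_map_nth) simp

lemma Par_monom: "Par (fls_monom c n) = fls_monom (par c) n"
  by (rule fls_eqI) simp

lemma Par_add: "Par (f + g) = Par f + Par g"
  by (rule fls_eqI) (simp add: par_add)

lemma Par_E0: "f \<in> E0 \<Longrightarrow> Par f = f"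
  by (rule fls_eqI) (simp add: E0_def par_R0)

lemma Par_E1: "f \<in> E1 \<Longrightarrow> Par f = - f"
  by (rule fls_eqI) (simp add: E1_def par_R1)

lemma fls_contadd_Par: "fls_contadd A \<Longrightarrow> fls_contadd (\<lambda>f. Par (A f))"
  by (rule fls_contadd_map) (simp_all add: par_add)

lemma Par_mult: "Par (f * g) = Par f * Par g"
proof (rule fls_contadd2_eqI[where A = "\<lambda>f g. Par (f * g)"])
  show "Par (fls_monom c n * fls_monom d m) = Par (fls_monom c n) * Par (fls_monom d m)" for c n d m
    by (simp add: Par_monom par_mult)
qed (intro fls_contadd_intros fls_contadd_Par)+

lemma E0_central:
  assumes "f \<in> E0"
  shows "f * g = g * f"
proof (rule fls_contadd_eqI[where A = "\<lambda>g. f * g"])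
  show "f * fls_monom c n = fls_monom c n * f" for c n
    by (rule fls_eqI) (use assms in \<open>simp add: E0_def R0_central\<close>)
qed (intro fls_contadd_intros)+

lemma E1_mult_commute:
  assumes "f \<in> E1"
  shows "g * f = f * Par g"
proof (rule fls_contadd_eqI[where A = "\<lambda>g. g * f"])
  show "fls_monom c n * f = f * Par (fls_monom c n)" for c n
    by (rule fls_eqI) (use assms in \<open>simp add: E1_def Par_monom R1_mult_commute\<close>)
qed (intro fls_contadd_intros fls_contadd_Par)+

lemma E1_anticommute: "f \<in> E1 \<Longrightarrow> g \<in> E1 \<Longrightarrow> g * f = - (f * g)"
  using E1_mult_commute[of f g] by (simp add: Par_E1)

text \<open>Anticommutation alone gives 2 f^2 = 0, and 2 may be a zero divisor. Instead the terms
  \<open>i\<close> and \<open>n - i\<close> of the convolution cancel in pairs, and a middle term is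
  the square of an odd scalar.\<close>

lemma E1_square:
  assumes "f \<in> E1"
  shows "f * f = 0"
proof (rule fls_zero_eqI)
  fix n
  let ?a = "fls_subdegree f"
  let ?I = "{?a..n - ?a}" and ?g = "\<lambda>i. f $$ i * f $$ (n - i)"
  have anti: "?g (n - i) = - ?g i" for i
    using R1_anticommute[of "f $$ (n - i)" "f $$ i"] assms by (simp add: E1_def)
  have mid: "?g i = 0" if "2 * i = n" for i
  proof -
    have "n - i = i" using that by simp
    then show ?thesis using assms by (simp add: E1_def R1_square)
  qed
  have "(f * f) $$ n = sum ?g ?I" by (rule fls_times_nth(2))
  also have "?I = {i\<in>?I. 2 * i < n} \<union> ({i\<in>?I. 2 * i = n} \<union> {i\<in>?I. 2 * i > n})" by auto
  also have "sum ?g \<dots> = sum ?g {i\<in>?I. 2 * i < n} + (sum ?g {i\<in>?I. 2 * i = n} + sum ?g {i\<in>?I. 2 * i > n})"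
    by (subst sum.union_disjoint; (subst sum.union_disjoint)?)
      (auto simp del: atLeastAtMost_iff)
  also have "sum ?g {i\<in>?I. 2 * i > n} = (\<Sum>i\<in>{i\<in>?I. 2 * i < n}. ?g (n - i))"
    by (rule sum.reindex_bij_witness[of _ "\<lambda>i. n - i" "\<lambda>i. n - i"]) auto
  also have "\<dots> = - sum ?g {i\<in>?I. 2 * i < n}"
    by (simp only: anti sum_negf)
  also have "sum ?g {i\<in>?I. 2 * i = n} = 0"
    by (rule sum.neutral) (use mid in auto)
  finally show "(f * f) $$ n = 0" by simp
qed

lemma E0_0 [simp]: "0 \<in> E0" and E1_0 [simp]: "0 \<in> E1" and E0_1 [simp]: "1 \<in> E0"
  by (simp_all add: E0_def E1_def)

lemma E0_X [simp]: "fls_X \<in> E0"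
  by (simp add: E0_def)

lemma E0_monom: "c \<in> R0 \<Longrightarrow> fls_monom c n \<in> E0"
  by (simp add: E0_def)

lemma E0_add: "f \<in> E0 \<Longrightarrow> g \<in> E0 \<Longrightarrow> f + g \<in> E0"
  and E1_add: "f \<in> E1 \<Longrightarrow> g \<in> E1 \<Longrightarrow> f + g \<in> E1"
  and E0_diff: "f \<in> E0 \<Longrightarrow> g \<in> E0 \<Longrightarrow> f - g \<in> E0"
  by (simp_all add: E0_def E1_def R0_add R1_add R0_diff)

lemma E0_mult: "f \<in> E0 \<Longrightarrow> g \<in> E0 \<Longrightarrow> f * g \<in> E0"
  and E11_mult: "f \<in> E1 \<Longrightarrow> g \<in> E1 \<Longrightarrow> f * g \<in> E0"
  and E01_mult: "f \<in> E0 \<Longrightarrow> g \<in> E1 \<Longrightarrow> f * g \<in> E1"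
  and E10_mult: "f \<in> E1 \<Longrightarrow> g \<in> E0 \<Longrightarrow> f * g \<in> E1"
  unfolding E0_def E1_def mem_Collect_eq fls_times_nth(2)
  by (blast intro: R0_sum R1_sum R0_mult R11_mult R01_mult R10_mult)+

lemma E0_power: "f \<in> E0 \<Longrightarrow> f ^ n \<in> E0"
  by (induction n) (simp_all add: E0_mult)

lemma E0_deriv: "f \<in> E0 \<Longrightarrow> fls_deriv f \<in> E0"
  and E1_deriv: "f \<in> E1 \<Longrightarrow> fls_deriv f \<in> E1"
  unfolding E0_def E1_def mem_Collect_eq fls_deriv_nth
  using R0_of_int by (blast intro: R0_mult R01_mult)+

text \<open>Taking even parts is linear over \<open>E0\<close>, so the even part of \<open>g\<close>
  is again a right inverse of the central \<open>f\<close>; inverses of central elements are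
  unique.\<close>

lemma inverse_in_E0:
  assumes "f \<in> E0" "f * g = 1"
  shows "g \<in> E0"
proof -
  have ev0: "ev 0 = 0" by (simp add: ev_R0)
  let ?h = "fls_map ev g"
  have h: "?h \<in> E0" by (simp add: E0_def fls_map_nth ev0 ev_in_R0)
  have ev_mult: "fls_map ev (f * g') = f * fls_map ev g'" for g'
  proof (rule fls_contadd_eqI[where A = "\<lambda>g. fls_map ev (f * g)"])
    show "fls_map ev (f * fls_monom c n) = f * fls_map ev (fls_monom c n)" for c n
    proof (rule fls_eqI)
      fix m
      have "fls_map ev (fls_monom c n) = fls_monom (ev c) n"
        by (rule fls_eqI) (simp add: fls_map_nth ev0)
      then show "fls_map ev (f * fls_monom c n) $$ m = (f * fls_map ev (fls_monom c n)) $$ m"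
        using assms(1) by (simp add: fls_map_nth ev0 ev_mult_R0 E0_def)
    qed
  qed (intro fls_contadd_intros fls_contadd_map ev_add)+
  have "fls_map ev 1 = 1" by (rule fls_eqI) (simp add: fls_map_nth ev0 ev_R0)
  then have "f * ?h = 1" using ev_mult[of g] assms(2) by simp
  then have "g = g * (f * ?h)" by simp
  also have "\<dots> = (f * g) * ?h" using E0_central[OF assms(1), of g] by (simp add: mult.assoc)
  also have "\<dots> = ?h" using assms(2) by simp
  finally show ?thesis using h by simp
qed

lemma seven_iff: "seven R0 R1 x \<longleftrightarrow> fst x \<in> E0 \<and> snd x \<in> E1"
  and sodd_iff: "sodd R0 R1 x \<longleftrightarrow> fst x \<in> E1 \<and> snd x \<in> E0"
  by (auto simp: seven_def sodd_def E0_def E1_def)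

end

section \<open>Complete filtrations and perturbation\<close>

text \<open>A multiplicative weight on scalars: \<open>J d\<close> stands for weight at least
  \<open>d\<close>. The cutoff \<open>C\<close> is what makes the induced filtration of series
  complete.\<close>

locale fls_filtration =
  fixes J :: "int \<Rightarrow> 'a::ring_1 set" and C :: int
  assumes J_nonpos: "d \<le> 0 \<Longrightarrow> J d = UNIV"
    and J_0: "0 \<in> J d"
    and J_add: "x \<in> J d \<Longrightarrow> y \<in> J d \<Longrightarrow> x + y \<in> J d"
    and J_mono: "d \<le> e \<Longrightarrow> J e \<subseteq> J d"
    and J_mult: "x \<in> J d \<Longrightarrow> y \<in> J e \<Longrightarrow> x * y \<in> J (d + e)"
    and J_top: "C \<le> d \<Longrightarrow> J d = {0}"
begin

lemma J_uminus: "x \<in> J d \<Longrightarrow> - x \<in> J d"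
  using J_mult[of "-1" 0 x d] by (simp add: J_nonpos)

lemma J_diff: "x \<in> J d \<Longrightarrow> y \<in> J d \<Longrightarrow> x - y \<in> J d"
  using J_add[OF _ J_uminus] by fastforce

lemma J_sum: "(\<And>i. i \<in> S \<Longrightarrow> f i \<in> J d) \<Longrightarrow> sum f S \<in> J d"
  by (induction S rule: infinite_finite_induct) (simp_all add: J_0 J_add)

text \<open>The weight of a term is its degree plus the weight of its coefficient; z itself has
  weight 1.\<close>

definition F :: "int \<Rightarrow> 'a fls set" where
  "F n = {f. \<forall>m. f $$ m \<in> J (n - m)}"

lemma F_D: "f \<in> F n \<Longrightarrow> f $$ m \<in> J (n - m)"
  by (simp add: F_def)

lemma F_0: "0 \<in> F n"
  by (simp add: F_def J_0)

lemma F_add: "f \<in> F n \<Longrightarrow> g \<in> F n \<Longrightarrow> f + g \<in> F n"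
  by (simp add: F_def J_add)

lemma F_diff: "f \<in> F n \<Longrightarrow> g \<in> F n \<Longrightarrow> f - g \<in> F n"
  by (simp add: F_def J_diff)

lemma F_mono:
  assumes "f \<in> F n" "m \<le> n"
  shows "f \<in> F m"
proof -
  have "f $$ k \<in> J (m - k)" for k
    using F_D[OF assms(1), of k] J_mono[of "m - k" "n - k"] assms(2) by auto
  then show ?thesis by (simp add: F_def)
qed

lemma F_mult:
  assumes "f \<in> F a" "g \<in> F b"
  shows "f * g \<in> F (a + b)"
proof -
  have "f $$ i * g $$ (m - i) \<in> J (a + b - m)" for i m
    using J_mult[OF F_D[OF assms(1), of i] F_D[OF assms(2), of "m - i"]] by (simp add: algebra_simps)
  then show ?thesis by (auto simp: F_def fls_times_nth(2) intro: J_sum)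
qed

text \<open>With \<open>above_imp_F\<close> this squeezes \<open>F\<close> between z-adic
  neighbourhoods at a fixed distance, so both filtrations define the same topology.\<close>

lemma F_imp_above:
  assumes "f \<in> F n"
  shows "f \<in> fls_above (n - C + 1)"
proof (rule fls_aboveI)
  fix m assume "m < n - C + 1"
  then show "f $$ m = 0" using F_D[OF assms, of m] J_top[of "n - m"] by simp
qed

lemma above_imp_F:
  assumes "f \<in> fls_above n"
  shows "f \<in> F n"
proof -
  have "f $$ m \<in> J (n - m)" for m
    using fls_aboveD[OF assms, of m] J_nonpos[of "n - m"] J_0 by (cases "m < n") auto
  then show ?thesis by (simp add: F_def)
qed

lemma F_monom: "fls_monom c n \<in> F n"
  by (rule above_imp_F[OF fls_monom_above])

lemma F_eq_0:
  assumes "\<And>k::nat. f \<in> F (n + int k)"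
  shows "f = 0"
proof (rule fls_eq_zero_above)
  fix M
  have "f \<in> fls_above (n + int (nat (M - n + C)) - C + 1)" by (rule F_imp_above[OF assms])
  then show "\<exists>N\<ge>M. f \<in> fls_above N" by (intro exI conjI) auto
qed

lemma F_limit:
  assumes "\<And>k::nat. s (Suc k) - s k \<in> F (n + int k)"
  obtains f where "\<And>k. f - s k \<in> F (n + int k)"
proof -
  have cauchy: "s (k + j) - s k \<in> F (n + int k)" for k j
  proof (induction j)
    case (Suc j)
    have "s (Suc (k + j)) - s (k + j) \<in> F (n + int k)"
      by (rule F_mono[OF assms]) simp
    from F_add[OF this Suc] show ?case by simp
  qed (simp add: F_0)
  \<comment> \<open>From index \<open>K m\<close> on, coefficient \<open>m\<close> is stationary:
    later differences lie in \<open>J (n + k - m)\<close>, which is 0 once \<open>n + k - m\<close>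
    reaches \<open>C\<close>.\<close>
  define K where "K = (\<lambda>m. nat (m + C - n))"
  define f where "f = Abs_fls (\<lambda>m. s (K m) $$ m)"
  have f_nth: "f $$ m = s (K m) $$ m" for m
    unfolding f_def
  proof (rule nth_Abs_fls_lower_bound, intro allI impI)
    \<comment> \<open>In these degrees \<open>K m = 0\<close>, so the coefficient is taken from
      \<open>s 0\<close>, which vanishes below its subdegree.\<close>
    fix m assume "m < min (n - C) (fls_subdegree (s 0))"
    then show "s (K m) $$ m = 0" by (simp add: K_def)
  qed
  have "f - s k \<in> F (n + int k)" for k
  proof -
    have "f $$ m - s k $$ m \<in> J (n + int k - m)" for m
    proof (cases "k \<le> K m")
      case True
      then show ?thesis
        using F_D[OF cauchy[of k "K m - k"], of m] by (simp add: f_nth)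
    next
      case False
      have "J (n + int (K m) - m) = {0}" by (rule J_top) (simp add: K_def)
      then have "s k $$ m = s (K m) $$ m"
        using F_D[OF cauchy[of "K m" "k - K m"], of m] False by simp
      then show ?thesis by (simp add: f_nth J_0)
    qed
    then show ?thesis by (simp add: F_def)
  qed
  then show ?thesis by (rule that)
qed

text \<open>Successive approximation: correcting by \<open>L'\<close> of the current error leaves an
  error of weight one higher, so the corrections converge and the limit solves the equation
  exactly.\<close>

lemma perturbation_surj:
  assumes add: "\<And>f g. T (f + g) = T f + T g"
    and pert: "\<And>n f. f \<in> F n \<Longrightarrow> T f - L f \<in> F (n + 1)"
    and L: "\<And>n f. f \<in> F n \<Longrightarrow> L f \<in> F n"
    and L': "\<And>n f. f \<in> F n \<Longrightarrow> L' f \<in> F n" "\<And>f. L (L' f) = f"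
    and g: "g \<in> F n"
  obtains f where "f \<in> F n" "T f = g"
proof -
  have minus: "T (f - h) = T f - T h" for f h
    using add[of "f - h" h] by simp
  have T_F: "T f \<in> F m" if "f \<in> F m" for f m
    using F_add[OF F_mono[OF pert[OF that], of m] L[OF that]] by simp
  define s where "s = rec_nat 0 (\<lambda>_ f. f + L' (g - T f))"
  have s_0: "s 0 = 0" and s_Suc: "s (Suc k) = s k + L' (g - T (s k))" for k
    by (simp_all add: s_def)
  have res: "g - T (s k) \<in> F (n + int k)" for k
  proof (induction k)
    case 0
    have "T 0 = 0" using add[of 0 0] by simp
    then show ?case using g by (simp add: s_0)
  next
    case (Suc k)
    let ?r = "g - T (s k)"
    \<comment> \<open>The new error is \<open>L (L' ?r) - T (L' ?r)\<close>, because
      \<open>L'\<close> is a right inverse of \<open>L\<close>.\<close>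
    have "0 - (T (L' ?r) - L (L' ?r)) \<in> F (n + int k + 1)"
      using F_diff[OF F_0 pert[OF L'(1)[OF Suc]]] by simp
    also have "0 - (T (L' ?r) - L (L' ?r)) = g - T (s (Suc k))"
      by (simp add: L'(2) s_Suc add)
    finally show ?case by (simp add: algebra_simps)
  qed
  have "s (Suc k) - s k \<in> F (n + int k)" for k
    using L'(1)[OF res] by (simp add: s_Suc)
  then obtain f where f: "\<And>k. f - s k \<in> F (n + int k)" using F_limit by blast
  have "g - T f \<in> F (n + int k)" for k
    using F_diff[OF res T_F[OF f], of k] by (simp add: minus)
  then have "g - T f = 0" by (rule F_eq_0)
  moreover have "f \<in> F n" using f[of 0] by (simp add: s_0)
  ultimately show ?thesis using that by simp
qed

text \<open>On the kernel of \<open>T\<close>, \<open>L f\<close> equals minus the perturbation, so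
  it gains a weight; undoing \<open>L\<close> keeps it. The weight of \<open>f\<close> therefore
  grows without bound.\<close>

lemma perturbation_inj:
  assumes pert: "\<And>n f. f \<in> F n \<Longrightarrow> T f - L f \<in> F (n + 1)"
    and L': "\<And>n f. f \<in> F n \<Longrightarrow> L' f \<in> F n" "\<And>f. L' (L f) = f"
    and f: "T f = 0"
  shows "f = 0"
proof (rule F_eq_0)
  fix k :: nat
  show "f \<in> F (fls_subdegree f + int k)"
  proof (induction k)
    case 0
    then show ?case by (simp add: above_imp_F fls_above_subdegree)
  next
    case (Suc k)
    have "0 - (T f - L f) \<in> F (fls_subdegree f + int k + 1)"
      by (rule F_diff[OF F_0 pert[OF Suc]])
    then have "L' (L f) \<in> F (fls_subdegree f + int k + 1)" using f L'(1) by simp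
    then show ?case by (simp add: L'(2) algebra_simps)
  qed
qed

text \<open>Multiplication by u / z is a perturbation of multiplication by the scalar
  \<open>a\<close>, so it hits 1; the preimage divided by z is the inverse.\<close>

lemma right_inverse_exists:
  assumes u: "u - fls_monom a 1 \<in> F 2" and ab: "a * b = 1"
  obtains w where "w \<in> F (-1)" "u * w = 1"
proof -
  let ?T = "\<lambda>f. fls_monom 1 (-1) * u * f"
  have pert: "?T f - fls_monom a 0 * f \<in> F (n + 1)" if "f \<in> F n" for f n
  proof -
    have "fls_monom 1 (-1) * ((u - fls_monom a 1) * f) \<in> F (-1 + (2 + n))"
      by (intro F_mult F_monom u that)
    moreover have "fls_monom 1 (-1) * ((u - fls_monom a 1) * f) = ?T f - fls_monom a 0 * f"
      by (simp add: left_diff_distrib right_diff_distrib flip: mult.assoc)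
    ultimately show ?thesis by (simp add: algebra_simps)
  qed
  have L: "fls_monom c 0 * f \<in> F n" if "f \<in> F n" for c f n
    using F_mult[OF F_monom that, of c 0] by simp
  have "1 \<in> F 0" by (simp add: fls_one_conv_monom F_monom)
  moreover have "fls_monom a 0 * (fls_monom b 0 * f) = f" for f
    using ab by (simp add: fls_one_conv_monom[symmetric] flip: mult.assoc)
  ultimately obtain f where f: "f \<in> F 0" "?T f = 1"
    using perturbation_surj[of ?T "\<lambda>f. fls_monom a 0 * f" "\<lambda>f. fls_monom b 0 * f" 1 0,
        OF distrib_left pert L L] by blast
  have "u * (f * fls_monom 1 (-1)) = u * f * fls_monom 1 (-1)" by (simp add: mult.assoc)
  also have "\<dots> = fls_monom 1 (-1) * (u * f)" by (rule fls_eqI) simp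
  also have "\<dots> = ?T f" by (simp add: mult.assoc)
  finally show ?thesis using that[of "f * fls_monom 1 (-1)"] F_mult[OF f(1) F_monom, of 1 "-1"] f(2)
    by simp
qed

text \<open>The weight \<open>s\<close> is left open to serve both \<open>u\<close> (with s = 1) and
  its inverse (with s = -1).\<close>

lemma power_diff_F:
  assumes "x \<in> F s" "y \<in> F s" "x - y \<in> F (s + 1)"
  shows "x ^ k - y ^ k \<in> F (s * int k + 1)" and "x ^ k \<in> F (s * int k)"
proof -
  have one: "1 \<in> F 0" by (simp add: fls_one_conv_monom F_monom)
  have pow: "z ^ k \<in> F (s * int k)" if "z \<in> F s" for z k
  proof (induction k)
    case (Suc k)
    from F_mult[OF that this] show ?case by (simp add: algebra_simps)
  qed (simp add: one)
  show "x ^ k \<in> F (s * int k)" using pow assms(1) .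
  show "x ^ k - y ^ k \<in> F (s * int k + 1)"
  proof (induction k)
    case (Suc k)
    have "x * (x ^ k - y ^ k) \<in> F (s + (s * int k + 1))" by (rule F_mult[OF assms(1) Suc])
    moreover have "(x - y) * y ^ k \<in> F (s + 1 + s * int k)" by (rule F_mult[OF assms(3) pow[OF assms(2)]])
    ultimately have "x * (x ^ k - y ^ k) + (x - y) * y ^ k \<in> F (s * int (Suc k) + 1)"
      by (intro F_add) (simp_all add: algebra_simps)
    then show ?case by (simp add: algebra_simps)
  qed (simp add: F_0)
qed

end

section \<open>Integral powers of a unit, and substitution into Laurent series\<close>

definition fls_zpow :: "'a::ring_1 fls \<Rightarrow> 'a fls \<Rightarrow> int \<Rightarrow> 'a fls" where
  "fls_zpow u w n = (if 0 \<le> n then u ^ nat n else w ^ nat (- n))"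

lemma fls_zpow_0 [simp]: "fls_zpow u w 0 = 1" and fls_zpow_1 [simp]: "fls_zpow u w 1 = u"
  by (simp_all add: fls_zpow_def)

text \<open>Both one-sided equations enter: going up through negative exponents cancels
  \<open>u * w\<close>, going down cancels \<open>w * u\<close>.\<close>

lemma fls_zpow_add:
  assumes uw: "u * w = 1" "w * u = 1"
  shows "fls_zpow u w (m + n) = fls_zpow u w m * fls_zpow u w n"
proof -
  have up: "fls_zpow u w (n + 1) = u * fls_zpow u w n" for n
  proof (cases "0 \<le> n")
    case True
    then show ?thesis by (simp add: fls_zpow_def nat_add_distrib)
  next
    case False
    then have "nat (- n) = Suc (nat (- (n + 1)))" by simp
    then have "u * w ^ nat (- n) = w ^ nat (- (n + 1))"
      using uw(1) by (simp flip: mult.assoc)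
    then show ?thesis using False by (auto simp: fls_zpow_def)
  qed
  have down: "fls_zpow u w (n - 1) = w * fls_zpow u w n" for n
    using up[of "n - 1"] uw(2) by (simp flip: mult.assoc)
  show ?thesis
  proof (induction m rule: int_induct[where k = 0])
    case (step1 i)
    have "fls_zpow u w (i + 1 + n) = u * fls_zpow u w (i + n)"
      using up[of "i + n"] by (simp add: algebra_simps)
    then show ?case by (simp add: step1 up mult.assoc)
  next
    case (step2 i)
    have "fls_zpow u w (i - 1 + n) = w * fls_zpow u w (i + n)"
      using down[of "i + n"] by (simp add: algebra_simps)
    then show ?case by (simp add: step2 down mult.assoc)
  qed simp
qed

text \<open>Meaningful only if \<open>Z n\<close> tends to \<open>0\<close> as \<open>n\<close> grows: then the support below is finite.\<close>

definition fls_subst :: "(int \<Rightarrow> 'a::ring_1 fls) \<Rightarrow> 'a fls \<Rightarrow> 'a fls" where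
  "fls_subst Z f = Abs_fls (\<lambda>m. \<Sum>n | f $$ n * Z n $$ m \<noteq> 0. f $$ n * Z n $$ m)"

text \<open>The loss \<open>K\<close> is uniform in \<open>n\<close>, so coefficient
  \<open>m\<close> receives contributions only from degrees up to \<open>m + K\<close>, whatever
  \<open>f\<close> is.\<close>

lemma fls_subst_nth:
  assumes Z: "\<And>n. Z n \<in> fls_above (n - K)" and f: "f \<in> fls_above lo"
  shows "fls_subst Z f $$ m = (\<Sum>n\<in>{lo..m + K}. f $$ n * Z n $$ m)"
proof -
  have supp: "(\<Sum>n | f $$ n * Z n $$ m \<noteq> 0. f $$ n * Z n $$ m) = (\<Sum>n\<in>{lo..m + K}. f $$ n * Z n $$ m)" for m
  proof (rule sum.mono_neutral_left)
    show "{n. f $$ n * Z n $$ m \<noteq> 0} \<subseteq> {lo..m + K}"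
    proof
      fix n assume "n \<in> {n. f $$ n * Z n $$ m \<noteq> 0}"
      then have "f $$ n \<noteq> 0" "Z n $$ m \<noteq> 0" by auto
      then have "\<not> n < lo" "\<not> m < n - K" using fls_aboveD[OF f] fls_aboveD[OF Z] by blast+
      then show "n \<in> {lo..m + K}" by simp
    qed
  qed auto
  have "\<forall>m<lo - K. (\<Sum>n | f $$ n * Z n $$ m \<noteq> 0. f $$ n * Z n $$ m) = 0"
    by (simp add: supp)
  then show ?thesis
    unfolding fls_subst_def by (simp add: nth_Abs_fls_lower_bound[where N = "lo - K"] supp)
qed

lemma fls_contadd_subst:
  fixes Z :: "int \<Rightarrow> 'a::ring_1 fls"
  assumes Z: "\<And>n. Z n \<in> fls_above (n - K)"
  shows "fls_contadd (fls_subst Z)"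
  unfolding fls_contadd_def
proof (intro conjI allI)
  fix f g :: "'a fls"
  \<comment> \<open>A common lower bound gives the three sums the same index set, even if leading
    terms of \<open>f + g\<close> cancel.\<close>
  let ?lo = "min (fls_subdegree f) (fls_subdegree g)"
  have "f \<in> fls_above ?lo" "g \<in> fls_above ?lo" by (auto simp: fls_above_def)
  then show "fls_subst Z (f + g) = fls_subst Z f + fls_subst Z g"
    by (intro fls_eqI) (simp add: fls_subst_nth[OF Z, where lo = ?lo] fls_above_add distrib_right sum.distrib)
next
  fix M
  have "\<forall>f\<in>fls_above (M + K). fls_subst Z f \<in> fls_above M"
    by (auto intro!: fls_aboveI simp: fls_subst_nth[OF Z])
  then show "\<exists>N. \<forall>f\<in>fls_above N. fls_subst Z f \<in> fls_above M" by blast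
qed

lemma fls_subst_monom:
  assumes Z: "\<And>n. Z n \<in> fls_above (n - K)"
  shows "fls_subst Z (fls_monom c n) = fls_const c * Z n"
proof (rule fls_eqI)
  fix m
  have "fls_subst Z (fls_monom c n) $$ m = (\<Sum>k\<in>{n..m + K}. if k = n then c * Z n $$ m else 0)"
    by (subst fls_subst_nth[OF Z fls_monom_above]) (intro sum.cong, auto)
  also have "\<dots> = c * Z n $$ m"
    using fls_aboveD[OF Z, of m n] by auto
  finally show "fls_subst Z (fls_monom c n) $$ m = (fls_const c * Z n) $$ m" by simp
qed

section \<open>Filtrations by powers of a nilpotent ideal\<close>

text \<open>For central \<open>A\<close> this is membership in the \<open>k\<close>-th power of the
  ideal generated by \<open>A\<close>, the 0-th power being the whole ring. Each rule adds a single
  product, so inductions can peel off one generator at a time.\<close>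

inductive ideal_pow :: "'a::ring_1 set \<Rightarrow> nat \<Rightarrow> 'a \<Rightarrow> bool" for A where
  base: "ideal_pow A 0 x"
| zero: "ideal_pow A (Suc k) 0"
| step: "a \<in> A \<Longrightarrow> ideal_pow A k x \<Longrightarrow> ideal_pow A (Suc k) y \<Longrightarrow> ideal_pow A (Suc k) (a * x + y)"

lemma ideal_pow_0: "ideal_pow A k 0"
  by (cases k) (auto intro: ideal_pow.intros)

lemma ideal_pow_add: "ideal_pow A k x \<Longrightarrow> ideal_pow A k y \<Longrightarrow> ideal_pow A k (x + y)"
proof (induction rule: ideal_pow.induct)
  case (step a k x y')
  then show ?case using ideal_pow.step[OF step(1,2), of "y' + y"] by (simp add: add.assoc)
qed (auto intro: ideal_pow.intros)

lemma ideal_pow_lmult: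
  assumes central: "\<And>a x. a \<in> A \<Longrightarrow> a * x = x * a" and "ideal_pow A k x"
  shows "ideal_pow A k (r * x)"
  using assms(2)
proof (induction rule: ideal_pow.induct)
  case (step a k x y)
  have "r * (a * x + y) = a * (r * x) + r * y"
    using central[OF step(1), of r] by (simp add: distrib_left flip: mult.assoc)
  then show ?case using step ideal_pow.step by metis
qed (auto intro: ideal_pow.intros)

lemma ideal_pow_antimono:
  assumes central: "\<And>a x. a \<in> A \<Longrightarrow> a * x = x * a" and "ideal_pow A k x" "l \<le> k"
  shows "ideal_pow A l x"
proof -
  have pred: "ideal_pow A k x \<Longrightarrow> ideal_pow A (k - 1) x" for k x
  proof (induction rule: ideal_pow.induct)
    case (step a k x y)
    then show ?case
      using ideal_pow_add[OF ideal_pow_lmult[OF central step(2), of a] step.IH(2)[simplified]] by simp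
  qed (auto intro: ideal_pow_0 ideal_pow.intros)
  have "ideal_pow A (k - j) x" for j
  proof (induction j)
    case (Suc j)
    from pred[OF this] show ?case by simp
  qed (simp add: assms(2))
  from this[of "k - l"] show ?thesis using assms(3) by simp
qed

lemma ideal_pow_mult:
  assumes central: "\<And>a x. a \<in> A \<Longrightarrow> a * x = x * a" and "ideal_pow A k x" and y: "ideal_pow A l y"
  shows "ideal_pow A (k + l) (x * y)"
  using assms(2)
proof (induction rule: ideal_pow.induct)
  case (base x)
  show ?case using ideal_pow_lmult[OF central y] by simp
next
  case (step a k x x')
  then show ?case using ideal_pow.step[of a A "k + l" "x * y" "x' * y"]
    by (simp add: distrib_right mult.assoc)
qed (simp add: ideal_pow_0)

text \<open>Induction on the generators: a new \<open>a\<close> with a^e = 0 raises the index from L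
  to e + L. In the generalised claim a^i y x = 0, the generators occurring in \<open>x\<close> are
  moved one by one into the power of \<open>a\<close> or into \<open>y\<close>, which keeps i + j +
  n constant.\<close>

lemma ideal_pow_nilpotent:
  assumes "finite A" "\<And>a x. a \<in> A \<Longrightarrow> a * x = x * a" "\<And>a. a \<in> A \<Longrightarrow> \<exists>k. a ^ k = 0"
  shows "\<exists>L. \<forall>x. ideal_pow A L x \<longrightarrow> x = 0"
  using assms
proof (induction A rule: finite_induct)
  case empty
  have "ideal_pow {} k x \<Longrightarrow> k = 1 \<Longrightarrow> x = 0" for k and x :: 'a
    by (induction rule: ideal_pow.induct) auto
  then show ?case by blast
next
  case (insert a A)
  have central: "\<And>b x. b \<in> A \<Longrightarrow> b * x = x * b" and a: "a * x = x * a" for x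
    using insert.prems(1) by auto
  obtain L where L: "\<And>x. ideal_pow A L x \<Longrightarrow> x = 0" using insert by auto
  obtain e where e: "a ^ e = 0" using insert.prems(2) by blast
  have "ideal_pow (insert a A) n x \<Longrightarrow>
      \<forall>i j y. ideal_pow A j y \<and> e + L \<le> i + j + n \<longrightarrow> a ^ i * y * x = 0" for n x
  proof (induction rule: ideal_pow.induct)
    case (base x)
    show ?case
    proof (intro allI impI)
      fix i j y assume *: "ideal_pow A j y \<and> e + L \<le> i + j + 0"
      show "a ^ i * y * x = 0"
      \<comment> \<open>Pigeonhole on i + j: either a^i = 0, or \<open>y\<close> lies in the
        \<open>L\<close>-th power of the old ideal, which is 0.\<close>
      proof (cases "e \<le> i")
        case True
        then have "a ^ i = a ^ e * a ^ (i - e)" by (simp flip: power_add)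
        then show ?thesis using e by simp
      next
        case False
        then have "ideal_pow A L y" using * ideal_pow_antimono[OF central, where k = j and l = L and x = y] by simp
        then have "y = 0" by (rule L)
        then show ?thesis by simp
      qed
    qed
  next
    case (step b n x y')
    show ?case
    proof (intro allI impI)
      fix i j y assume *: "ideal_pow A j y \<and> e + L \<le> i + j + Suc n"
      have "a ^ i * y * (b * x) = 0"
      proof (cases "b = a")
        case True
        have "a ^ Suc i * y * x = 0"
          using step.IH(1)[rule_format, of j y "Suc i"] * by simp
        moreover have "a ^ i * y * (a * x) = a ^ i * (y * a) * x" by (simp add: mult.assoc)
        moreover have "y * a = a * y" using a[of y] by simp
        moreover have "a ^ i * (a * y) * x = a ^ Suc i * y * x"
          by (simp only: power_Suc2 mult.assoc)
        ultimately show ?thesis using True by simp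
      next
        case False
        then have b: "b \<in> A" using step by simp
        have "ideal_pow A (Suc j) (b * y)"
          using ideal_pow.step[OF b, of j y 0] * by (simp add: ideal_pow.zero)
        then have "a ^ i * (b * y) * x = 0"
          using step.IH(1)[rule_format, of "Suc j" "b * y" i] * by simp
        then show ?thesis using central[OF b, of y] by (simp only: mult.assoc)
      qed
      moreover have "a ^ i * y * y' = 0" using step.IH(2) * by blast
      ultimately show "a ^ i * y * (b * x + y') = 0" by (simp add: distrib_left)
    qed
  qed simp
  from this[of "e + L"] have "\<forall>x. ideal_pow (insert a A) (e + L) x \<longrightarrow> x = 0"
    using ideal_pow.base[of A 1] by (metis add_0 le_refl mult_1 power_0)
  then show ?case by blast
qed

text \<open>\<open>J d\<close> is the \<open>\<lceil>d / W\<rceil>\<close>-th power of the ideal generated by \<open>A\<close>: a generator then counts as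
  much as \<open>W\<close> powers of the variable, which absorbs any pole of order less than \<open>W\<close>.\<close>

lemma nilpotent_filtration_exists:
  fixes A :: "'a::ring_1 set" and W :: int
  assumes "finite A" and central: "\<And>a x. a \<in> A \<Longrightarrow> a * x = x * a"
    and nilp: "\<And>a. a \<in> A \<Longrightarrow> \<exists>k. a ^ k = 0" and W: "1 \<le> W"
  obtains J C where "fls_filtration J C" "\<And>a d. a \<in> A \<Longrightarrow> d \<le> W \<Longrightarrow> a \<in> J d"
proof -
  obtain L where L: "\<And>x. ideal_pow A L x \<Longrightarrow> x = 0"
    using ideal_pow_nilpotent[OF assms(1-3)] by blast
  define lev where "lev = (\<lambda>d. nat ((d + W - 1) div W))"
  \<comment> \<open>This adjunction is the only property of the rounded quotient used below;
    monotonicity, subadditivity and the cutoff all follow from it.\<close>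
  have lev_le: "lev d \<le> k \<longleftrightarrow> d \<le> W * int k" for d k
  proof -
    have "lev d \<le> k \<longleftrightarrow> (d + W - 1) div W < int k + 1" by (auto simp: lev_def)
    also have "\<dots> \<longleftrightarrow> d + W - 1 < (int k + 1) * W"
    proof -
      let ?x = "d + W - 1"
      have x: "?x = W * (?x div W) + ?x mod W" and r: "0 \<le> ?x mod W" "?x mod W < W" using W by auto
      show ?thesis
      proof (cases "?x div W < int k + 1")
        case True
        then have "W * (?x div W) \<le> W * int k" using W by (intro mult_left_mono) auto
        then have "?x < W * int k + W" using x r by linarith
        then show ?thesis using True by (simp add: algebra_simps)
      next
        case False
        then have "W * (int k + 1) \<le> W * (?x div W)" using W by (intro mult_left_mono) auto
        then have "W * (int k + 1) \<le> ?x" using x r by linarith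
        then show ?thesis using False by (simp add: mult.commute)
      qed
    qed
    also have "\<dots> \<longleftrightarrow> d \<le> W * int k" by (simp add: algebra_simps) linarith
    finally show ?thesis .
  qed
  define J where "J = (\<lambda>d. {x. ideal_pow A (lev d) x})"
  note J_mono = ideal_pow_antimono[OF central]
  \<comment> \<open>At weight W L the level has reached the nilpotency index.\<close>
  have "fls_filtration J (W * int L)"
  proof
    fix d :: int assume "d \<le> 0"
    then have "lev d = 0" using lev_le[of d 0] by simp
    then show "J d = UNIV" by (auto simp: J_def ideal_pow.base)
  next
    fix d e :: int assume "d \<le> e"
    moreover have "e \<le> W * int (lev e)" using lev_le by blast
    ultimately have "lev d \<le> lev e" using lev_le[of d "lev e"] by linarith
    then show "J e \<subseteq> J d" by (auto simp: J_def intro: J_mono)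
  next
    fix x y and d e :: int assume "x \<in> J d" "y \<in> J e"
    then have xy: "ideal_pow A (lev d + lev e) (x * y)"
      by (auto simp: J_def intro: ideal_pow_mult[OF central])
    have "d \<le> W * int (lev d)" "e \<le> W * int (lev e)" using lev_le by blast+
    then have "lev (d + e) \<le> lev d + lev e" by (simp add: lev_le distrib_left)
    then show "x * y \<in> J (d + e)" using J_mono[OF _ xy] by (simp add: J_def)
  next
    fix d :: int assume d: "W * int L \<le> d"
    have "L \<le> lev d"
    proof (rule ccontr)
      assume "\<not> L \<le> lev d"
      then have *: "lev d \<le> L - 1" "1 \<le> L" by auto
      then have "d \<le> W * int (L - 1)" by (simp add: lev_le)
      moreover have "W * int (L - 1) = W * int L - W" using *(2) by (simp add: of_nat_diff algebra_simps)
      ultimately show False using d W by simp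
    qed
    then have "x = 0" if "ideal_pow A (lev d) x" for x using J_mono[OF _ that] L by blast
    then show "J d = {0}" by (auto simp: J_def ideal_pow_0)
  qed (auto simp: J_def ideal_pow_0 intro: ideal_pow_add)
  moreover have "a \<in> J d" if "a \<in> A" "d \<le> W" for a d
  proof -
    have "ideal_pow A 1 a"
      using ideal_pow.step[OF that(1), of 0 1 0] by (simp add: ideal_pow.intros)
    moreover have "lev d \<le> 1" using that(2) by (simp add: lev_le)
    ultimately show ?thesis using J_mono by (auto simp: J_def)
  qed
  ultimately show ?thesis by (rule that)
qed

section \<open>Admissible coordinates\<close>

context supercommutative_ring
begin

text \<open>The condition that \<open>Gamma1\<close> puts on the first component, isolated because z
  v^2 has to satisfy it as well.\<close>

definition coords :: "'a fls set" where
  "coords = {u \<in> E0. (\<exists>b\<in>R0. u $$ 1 * b = 1 \<and> b * u $$ 1 = 1) \<and> (\<forall>n<1. \<exists>k::nat. (u $$ n) ^ k = 0)}"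

lemma coords_filtration:
  assumes "u \<in> coords"
  obtains J C where "fls_filtration J C" "u - fls_monom (u $$ 1) 1 \<in> fls_filtration.F J 2"
proof -
  \<comment> \<open>A coefficient in degree m between \<open>?d\<close> and 0 must have weight 2 - m
    for its term to reach weight 2; the worst case m = \<open>?d\<close> dictates
    \<open>?W\<close>.\<close>
  let ?d = "fls_subdegree u"
  let ?A = "(\<lambda>m. u $$ m) ` {?d..0}" and ?W = "max 1 (2 - ?d)"
  have "finite ?A" by simp
  moreover have "a * x = x * a" if "a \<in> ?A" for a x
  proof -
    have "a \<in> R0" using that assms by (auto simp: coords_def E0_def)
    then show ?thesis by (rule R0_central)
  qed
  moreover have "\<exists>k. a ^ k = 0" if "a \<in> ?A" for a
    using that assms unfolding coords_def by force
  moreover have "1 \<le> ?W" by simp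
  ultimately obtain J C where J: "fls_filtration J C" "\<And>a d. a \<in> ?A \<Longrightarrow> d \<le> ?W \<Longrightarrow> a \<in> J d"
    using nilpotent_filtration_exists[of ?A ?W] by blast
  interpret fls_filtration J C by (rule J(1))
  have "(u - fls_monom (u $$ 1) 1) $$ m \<in> J (2 - m)" for m
  proof -
    consider "m < ?d" | "m = 1" | "m \<ge> 2" | "?d \<le> m" "m \<le> 0" by linarith
    then show ?thesis
    proof cases
      case 1
      then have "(u - fls_monom (u $$ 1) 1) $$ m = 0" by auto
      then show ?thesis by (simp only: J_0)
    next
      case 2
      then show ?thesis by (simp add: J_0)
    next
      case 3
      then show ?thesis by (simp add: J_nonpos)
    next
      case 4
      then have "u $$ m \<in> J (2 - m)" by (intro J(2)) auto
      then show ?thesis using 4 by simp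
    qed
  qed
  then have "u - fls_monom (u $$ 1) 1 \<in> F 2" by (simp add: F_def)
  with J(1) show ?thesis by (rule that)
qed

lemma coords_inverse:
  assumes "u \<in> coords"
  obtains w where "w \<in> E0" "u * w = 1"
proof -
  obtain J C where J: "fls_filtration J C" "u - fls_monom (u $$ 1) 1 \<in> fls_filtration.F J 2"
    using assms by (rule coords_filtration)
  interpret fls_filtration J C by (rule J(1))
  obtain b where "u $$ 1 * b = 1" using assms unfolding coords_def by blast
  from J(2) this obtain w where w: "u * w = 1" by (rule right_inverse_exists)
  have "u \<in> E0" using assms by (simp add: coords_def)
  then have "w \<in> E0" using w by (rule inverse_in_E0)
  then show ?thesis using w by (rule that)
qed

end

section \<open>Substitution of a coordinate\<close>

locale coordinate_change = supercommutative_ring R0 R1 + fls_filtration J C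
  for R0 R1 :: "'a::ring_1 set" and J :: "int \<Rightarrow> 'a set" and C :: int +
  fixes u w :: "'a fls" and a b :: 'a
  assumes u_E0: "u \<in> E0" and u_approx: "u - fls_monom a 1 \<in> F 2"
    and ab: "a * b = 1" "b * a = 1"
    and w_E0: "w \<in> E0" and uw: "u * w = 1"
begin

lemma wu: "w * u = 1"
  by (metis uw E0_central[OF u_E0])

abbreviation P :: "int \<Rightarrow> 'a fls" where "P \<equiv> fls_zpow u w"
abbreviation Q :: "int \<Rightarrow> 'a fls" where "Q \<equiv> fls_zpow (fls_monom a 1) (fls_monom b (- 1))"

lemma P_add: "P (m + n) = P m * P n"
  by (rule fls_zpow_add[OF uw wu])

lemma Q_add: "Q (m + n) = Q m * Q n"
  by (rule fls_zpow_add) (simp_all add: ab flip: fls_one_conv_monom)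

lemma P_E0: "P n \<in> E0"
  by (simp add: fls_zpow_def E0_power u_E0 w_E0)

lemma u_F: "u \<in> F 1"
  using F_add[OF F_mono[OF u_approx] F_monom[of a 1]] by simp

text \<open>The perturbation argument yields some inverse of weight -1; by uniqueness it is
  \<open>w\<close>.\<close>

lemma w_F: "w \<in> F (- 1)"
proof -
  obtain w' where w': "w' \<in> F (- 1)" "u * w' = 1"
    using right_inverse_exists[OF u_approx ab(1)] by blast
  have "w' = w * u * w'" by (simp add: wu)
  then have "w' = w" using w'(2) by (simp add: mult.assoc)
  then show ?thesis using w'(1) by simp
qed

text \<open>The difference 1/(a z) - 1/u equals w (u - a z) / (a z), of weight -1 + 2 - 1.\<close>

lemma w_approx: "w - fls_monom b (- 1) \<in> F 0"
proof -
  have "w * ((u - fls_monom a 1) * fls_monom b (- 1)) \<in> F (- 1 + (2 + (- 1)))"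
    by (intro F_mult w_F u_approx F_monom)
  moreover have "w * ((u - fls_monom a 1) * fls_monom b (- 1)) =
      w * u * fls_monom b (- 1) - w * (fls_monom a 1 * fls_monom b (- 1))"
    by (simp add: left_diff_distrib right_diff_distrib mult.assoc del: fls_monom_mult_monom)
  moreover have "\<dots> = fls_monom b (- 1) - w"
    using wu ab by (simp flip: fls_one_conv_monom)
  ultimately have "fls_monom b (- 1) - w \<in> F 0" by simp
  from F_diff[OF F_0 this] show ?thesis by simp
qed

lemma P_approx: "P n - Q n \<in> F (n + 1)" and P_F: "P n \<in> F n"
proof -
  have 1: "u ^ k - fls_monom a 1 ^ k \<in> F (1 * int k + 1)" "u ^ k \<in> F (1 * int k)" for k
    by (rule power_diff_F; use u_approx in \<open>simp add: u_F F_monom\<close>)+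
  have 2: "w ^ k - fls_monom b (- 1) ^ k \<in> F (- 1 * int k + 1)" "w ^ k \<in> F (- 1 * int k)" for k
    by (rule power_diff_F; use w_approx in \<open>simp add: w_F F_monom\<close>)+
  show "P n - Q n \<in> F (n + 1)" "P n \<in> F n"
    using 1[of "nat n"] 2[of "nat (- n)"] by (auto simp: fls_zpow_def add.commute)
qed

definition q :: "int \<Rightarrow> 'a" where "q n = (if 0 \<le> n then a ^ nat n else b ^ nat (- n))"

lemma Q_eq: "Q n = fls_monom (q n) n"
proof -
  have "fls_monom c k ^ l = fls_monom (c ^ l) (k * int l)" for c :: 'a and k l
    by (induction l) (simp_all add: fls_one_conv_monom algebra_simps)
  then show ?thesis by (simp add: fls_zpow_def q_def)
qed

lemma q_uminus: "q n * q (- n) = 1"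
proof -
  have "Q n * Q (- n) = 1" using Q_add[of n "- n"] by simp
  then have "fls_monom (q n * q (- n)) 0 $$ 0 = 1 $$ 0" by (simp only: Q_eq fls_monom_mult_monom) simp
  then show ?thesis by simp
qed

text \<open>The loss \<open>C\<close> does not depend on \<open>n\<close>, which is exactly what
  substitution requires of the family of powers.\<close>

lemma P_above: "P n \<in> fls_above (n - C)"
  using F_imp_above[OF P_F] by (rule fls_above_mono) simp

lemma Q_above: "Q n \<in> fls_above (n - C)"
  unfolding Q_eq using F_imp_above[OF F_monom] by (rule fls_above_mono) simp

definition T :: "'a fls \<Rightarrow> 'a fls" where "T = fls_subst P"

lemma T_nth: "f \<in> fls_above lo \<Longrightarrow> T f $$ m = (\<Sum>n\<in>{lo..m + C}. f $$ n * P n $$ m)"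
  unfolding T_def by (rule fls_subst_nth[OF P_above])

lemma T_contadd: "fls_contadd T"
  unfolding T_def by (rule fls_contadd_subst[OF P_above])

lemma fls_contadd_T: "fls_contadd A \<Longrightarrow> fls_contadd (\<lambda>f. T (A f))"
  by (rule fls_contadd_comp[OF T_contadd])

lemmas T_plus = fls_contadd_plus[OF T_contadd]
lemmas T_minus = fls_contadd_minus[OF T_contadd]
lemmas T_0 = fls_contadd_0[OF T_contadd]

lemma T_monom: "T (fls_monom c n) = fls_const c * P n"
  unfolding T_def by (rule fls_subst_monom[OF P_above])

lemma T_const: "T (fls_const c) = fls_const c"
  by (simp add: fls_const_conv_monom T_monom)

lemma T_1: "T 1 = 1"
  using T_const[of 1] by simp

lemma T_X: "T fls_X = u"
  by (simp add: fls_X_conv_monom T_monom)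

lemma T_mult: "T (f * g) = T f * T g"
proof (rule fls_contadd2_eqI[where A = "\<lambda>f g. T (f * g)"])
  fix c d :: 'a and m n
  have "T (fls_monom c n * fls_monom d m) = fls_const c * (fls_const d * P n) * P m"
    by (simp add: T_monom P_add flip: mult.assoc fls_const_mult_const)
  also have "fls_const d * P n = P n * fls_const d" by (simp add: E0_central[OF P_E0])
  finally show "T (fls_monom c n * fls_monom d m) = T (fls_monom c n) * T (fls_monom d m)"
    by (simp add: T_monom mult.assoc)
qed (intro fls_contadd_intros fls_contadd_T)+

text \<open>Downwards, the Leibniz rule for P i = P (i - 1) u is solved for the derivative of P (i -
  1) times \<open>u\<close>, and \<open>w\<close> cancels \<open>u\<close>; no division by integers
  occurs.\<close>

lemma deriv_P: "fls_deriv (P n) = of_int n * P (n - 1) * fls_deriv u"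
proof -
  let ?u' = "fls_deriv u"
  have comm: "x * ?u' = ?u' * x" for x by (rule E0_central[OF E0_deriv[OF u_E0], symmetric])
  have P_step: "P (i + 1) = P i * u" for i using P_add[of i 1] by simp
  have deriv_step: "fls_deriv (P (i + 1)) = P i * ?u' + fls_deriv (P i) * u" for i
    by (simp add: P_step)
  show ?thesis
  proof (induction n rule: int_induct[where k = 0])
    case (step1 i)
    have "of_int i * P (i - 1) * ?u' * u = of_int i * (P (i - 1) * u) * ?u'"
      using comm[of u] by (simp add: mult.assoc)
    also have "\<dots> = of_int i * P i * ?u'" using P_step[of "i - 1"] by simp
    finally show ?case using deriv_step[of i] step1 by (simp add: algebra_simps)
  next
    case (step2 i)
    have "fls_deriv (P (i - 1)) * u = of_int i * P (i - 1) * ?u' - P (i - 1) * ?u'"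
      using deriv_step[of "i - 1"] step2 by (simp add: algebra_simps)
    also have "\<dots> = of_int (i - 1) * P (i - 1) * ?u'" by (simp add: algebra_simps)
    finally have *: "fls_deriv (P (i - 1)) * u = of_int (i - 1) * P (i - 1) * ?u'" .
    have Pw: "P (i - 1) * w = P (i - 1 - 1)"
      using P_step[of "i - 1 - 1"] uw by (simp add: mult.assoc)
    have "fls_deriv (P (i - 1)) = fls_deriv (P (i - 1)) * u * w" using uw by (simp add: mult.assoc)
    also have "\<dots> = of_int (i - 1) * P (i - 1) * (?u' * w)" by (simp only: * mult.assoc)
    also have "?u' * w = w * ?u'" using comm by simp
    also have "of_int (i - 1) * P (i - 1) * (w * ?u') = of_int (i - 1) * (P (i - 1) * w) * ?u'"
      by (simp only: mult.assoc)
    finally show ?case by (simp only: Pw)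
  qed simp
qed

lemma T_deriv: "fls_deriv (T f) = T (fls_deriv f) * fls_deriv u"
proof (rule fls_contadd_eqI[where A = "\<lambda>f. fls_deriv (T f)"])
  fix c :: 'a and n
  have "fls_deriv (T (fls_monom c n)) = fls_const c * of_int n * P (n - 1) * fls_deriv u"
    by (simp add: T_monom deriv_P mult.assoc)
  also have "fls_const c * of_int n = fls_const (of_int n * c)"
    by (simp add: fls_of_int mult_of_int_commute)
  finally show "fls_deriv (T (fls_monom c n)) = T (fls_deriv (fls_monom c n)) * fls_deriv u"
    by (simp add: fls_deriv_monom T_monom)
qed (intro fls_contadd_intros fls_contadd_T)+

lemma T_Par: "Par (T f) = T (Par f)"
proof (rule fls_contadd_eqI[where A = "\<lambda>f. Par (T f)"])
  fix c :: 'a and n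
  show "Par (T (fls_monom c n)) = T (Par (fls_monom c n))"
    by (simp add: T_monom Par_mult Par_monom Par_E0[OF P_E0] fls_const_conv_monom)
qed (intro fls_contadd_intros fls_contadd_T fls_contadd_Par)+

lemma T_E0:
  assumes "f \<in> E0"
  shows "T f \<in> E0"
proof -
  have "f $$ n * P n $$ m \<in> R0" for n m
    using assms P_E0[of n] by (auto simp: E0_def intro: R0_mult)
  then show ?thesis
    by (auto simp: E0_def T_nth[OF fls_above_subdegree] intro!: R0_sum)
qed

lemma T_E1:
  assumes "f \<in> E1"
  shows "T f \<in> E1"
proof -
  have "f $$ n * P n $$ m \<in> R1" for n m
    using assms P_E0[of n] by (auto simp: E0_def E1_def intro: R10_mult)
  then show ?thesis
    by (auto simp: E1_def T_nth[OF fls_above_subdegree] intro!: R1_sum)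
qed

text \<open>With \<open>r = q\<close> this is f(z) -> f(a z), the leading part of \<open>T\<close>;
  exponents negated in \<open>q\<close> give its inverse. Written as a substitution, it can be
  compared with \<open>T\<close> term by term.\<close>

definition scale :: "(int \<Rightarrow> 'a) \<Rightarrow> 'a fls \<Rightarrow> 'a fls" where
  "scale r = fls_subst (\<lambda>n. fls_monom (r n) n)"

lemma scale_nth: "scale r f $$ m = f $$ m * r m"
proof -
  let ?lo = "min m (fls_subdegree f)"
  have "scale r f $$ m = (\<Sum>n = ?lo..m + 0. f $$ n * fls_monom (r n) n $$ m)"
    unfolding scale_def by (rule fls_subst_nth) (auto simp: fls_above_def)
  also have "\<dots> = (\<Sum>n = ?lo..m. if n = m then f $$ m * r m else 0)"
    by (rule sum.cong) auto
  finally show ?thesis by simp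
qed

lemma scale_F:
  assumes "f \<in> F n"
  shows "scale r f \<in> F n"
proof -
  have "f $$ m * r m \<in> J (n - m)" for m
    using J_mult[OF F_D[OF assms, of m], of "r m" 0] by (simp add: J_nonpos)
  then show ?thesis by (simp add: F_def scale_nth)
qed

lemma T_approx:
  assumes "f \<in> F n"
  shows "T f - scale q f \<in> F (n + 1)"
proof -
  let ?lo = "fls_subdegree f"
  have "(T f - scale q f) $$ m \<in> J (n + 1 - m)" for m
  proof -
    have "(T f - scale q f) $$ m = (\<Sum>k\<in>{?lo..m + C}. f $$ k * P k $$ m - f $$ k * Q k $$ m)"
      unfolding scale_def Q_eq[symmetric]
      by (simp add: T_nth[OF fls_above_subdegree] fls_subst_nth[OF Q_above fls_above_subdegree] sum_subtractf)
    also have "\<dots> = (\<Sum>k\<in>{?lo..m + C}. f $$ k * (P k - Q k) $$ m)"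
      by (simp add: right_diff_distrib)
    also have "\<dots> \<in> J (n + 1 - m)"
    proof (rule J_sum)
      fix k
      \<comment> \<open>The weights n - k and k + 1 - m add up to n + 1 - m.\<close>
      show "f $$ k * (P k - Q k) $$ m \<in> J (n + 1 - m)"
        using J_mult[OF F_D[OF assms, of k] F_D[OF P_approx, of k m]] by (simp add: algebra_simps)
    qed
    finally show ?thesis .
  qed
  then show ?thesis by (simp add: F_def)
qed

lemma T_surj_F:
  assumes "g \<in> F n"
  obtains f where "f \<in> F n" "T f = g"
proof -
  have "scale q (scale (\<lambda>n. q (- n)) f) = f" for f
    using q_uminus[of "- m" for m] by (intro fls_eqI) (simp add: scale_nth mult.assoc)
  then show ?thesis
    using perturbation_surj[of T "scale q" "scale (\<lambda>n. q (- n))" g n,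
        OF T_plus T_approx scale_F scale_F _ assms] that by blast
qed

lemma T_inj: "inj T"
proof (rule injI)
  fix f g assume "T f = T g"
  then have "T (f - g) = 0" by (simp add: T_minus)
  moreover have "scale (\<lambda>n. q (- n)) (scale q f) = f" for f
    using q_uminus by (intro fls_eqI) (simp add: scale_nth mult.assoc)
  ultimately have "f - g = 0"
    using perturbation_inj[of T "scale q" "scale (\<lambda>n. q (- n))" "f - g",
        OF T_approx scale_F] by blast
  then show "f = g" by simp
qed

definition S :: "'a fls \<Rightarrow> 'a fls" where "S = inv T"

lemma S_T [simp]: "S (T f) = f"
  unfolding S_def by (rule inv_f_f[OF T_inj])

lemma T_S [simp]: "T (S g) = g"
proof -
  obtain f where "T f = g"
    using T_surj_F[OF above_imp_F[OF fls_above_subdegree]] by blast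
  then show ?thesis by auto
qed

lemma S_F:
  assumes "g \<in> F n"
  shows "S g \<in> F n"
proof -
  obtain f where "f \<in> F n" "T f = g" using assms by (rule T_surj_F)
  then show ?thesis by auto
qed

text \<open>\<open>S\<close> preserves weights because preimages under \<open>T\<close> can be found
  in the same \<open>F n\<close>; comparing weights with degrees costs at most
  \<open>C\<close>.\<close>

lemma fls_contadd_S:
  assumes "fls_contadd A"
  shows "fls_contadd (\<lambda>f. S (A f))"
proof -
  have "fls_contadd S"
    unfolding fls_contadd_def
  proof (intro conjI allI)
    fix f g
    have "S (T (S f + S g)) = S (f + g)" unfolding T_plus by simp
    then show "S (f + g) = S f + S g" by simp
  next
    fix M
    have "S f \<in> fls_above M" if "f \<in> fls_above (M + C)" for f
      using F_imp_above[OF S_F[OF above_imp_F[OF that]]] by (rule fls_above_mono) simp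
    then show "\<exists>N. \<forall>f\<in>fls_above N. S f \<in> fls_above M" by blast
  qed
  then show ?thesis using assms by (rule fls_contadd_comp)
qed

end

section \<open>The automorphism attached to a pair\<close>

lemma zadic_iff: "x \<in> zadic N \<longleftrightarrow> fst x \<in> fls_above N \<and> snd x \<in> fls_above N"
  by (auto simp: zadic_def fls_above_def)

lemma zcontI:
  assumes add: "\<And>x y. \<phi> (sadd x y) = sadd (\<phi> x) (\<phi> y)"
    and c: "fls_contadd (\<lambda>f. fst (\<phi> (f, 0)))" "fls_contadd (\<lambda>f. snd (\<phi> (f, 0)))"
      "fls_contadd (\<lambda>g. fst (\<phi> (0, g)))" "fls_contadd (\<lambda>g. snd (\<phi> (0, g)))"
  shows "zcont \<phi>"
  unfolding zcont_def
proof
  fix M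
  have split: "\<phi> (f, g) = sadd (\<phi> (f, 0)) (\<phi> (0, g))" for f g
    using add[of "(f, 0)" "(0, g)"] by (simp add: sadd_def)
  obtain N1 where 1: "\<forall>f\<in>fls_above N1. fst (\<phi> (f, 0)) \<in> fls_above M"
    using c(1) unfolding fls_contadd_def by blast
  obtain N2 where 2: "\<forall>f\<in>fls_above N2. snd (\<phi> (f, 0)) \<in> fls_above M"
    using c(2) unfolding fls_contadd_def by blast
  obtain N3 where 3: "\<forall>f\<in>fls_above N3. fst (\<phi> (0, f)) \<in> fls_above M"
    using c(3) unfolding fls_contadd_def by blast
  obtain N4 where 4: "\<forall>f\<in>fls_above N4. snd (\<phi> (0, f)) \<in> fls_above M"
    using c(4) unfolding fls_contadd_def by blast
  let ?N = "max (max N1 N2) (max N3 N4)"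
  have "\<phi> x \<in> zadic M" if "x \<in> zadic ?N" for x
  proof -
    obtain f g where x: "x = (f, g)" by (rule prod.exhaust)
    then have fg: "f \<in> fls_above ?N" "g \<in> fls_above ?N" using that by (simp_all add: zadic_iff)
    have "f \<in> fls_above N1" "f \<in> fls_above N2" by (rule fls_above_mono[OF fg(1)], simp)+
    moreover have "g \<in> fls_above N3" "g \<in> fls_above N4" by (rule fls_above_mono[OF fg(2)], simp)+
    ultimately show ?thesis
      using 1 2 3 4 by (simp add: zadic_iff x split[of f g] sadd_def fls_above_add)
  qed
  then show "\<exists>N. \<phi> ` zadic N \<subseteq> zadic M" by blast
qed

locale superconformal_change = coordinate_change R0 R1 J C u w a b
  for R0 R1 :: "'a::ring_1 set" and J C u w a b +
  fixes \<eta> v v_inv :: "'a fls"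
  assumes \<eta>_E1: "\<eta> \<in> E1" and v_E0: "v \<in> E0" and v_inv_E0: "v_inv \<in> E0" and v_inv: "v * v_inv = 1"
    and v_square: "v * v = fls_deriv u + \<eta> * fls_deriv \<eta>"
begin

text \<open>The substitution of u + \<zeta> v \<eta> for z is a first-order Taylor expansion, exact
  since (\<zeta> v \<eta>)^2 = 0. In \<phi>(\<zeta>) g(\<phi>(z)) the cross term \<eta> \<zeta> v
  \<eta> g'(u) dies because \<eta>^2 = 0.\<close>

definition \<phi> :: "'a sls \<Rightarrow> 'a sls" where
  "\<phi> x = (T (fst x) + \<eta> * T (snd x), v * (\<eta> * T (fls_deriv (fst x)) + T (snd x)))"

text \<open>Obtained by solving \<open>\<phi> (f, g) = (p, r)\<close>: the second equation gives
  v_inv r = \<eta> T f' + T g, hence \<eta> v_inv r = \<eta> T g, which eliminates \<open>g\<close>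
  from the first; then \<open>g\<close> follows.\<close>

definition \<phi>_inv :: "'a sls \<Rightarrow> 'a sls" where
  "\<phi>_inv x = (let f = S (fst x - \<eta> * (v_inv * snd x)) in (f, S (v_inv * snd x - \<eta> * T (fls_deriv f))))"

lemma \<eta>_\<eta>: "\<eta> * (\<eta> * x) = 0"
  using E1_square[OF \<eta>_E1] by (simp flip: mult.assoc)

lemma mult_\<eta>: "x * (\<eta> * y) = \<eta> * (Par x * y)"
  using E1_mult_commute[OF \<eta>_E1, of x] by (simp flip: mult.assoc)

lemma mult_v: "x * (v * y) = v * (x * y)"
  using E0_central[OF v_E0, of x] by (simp flip: mult.assoc)

lemma Par_Par: "Par (Par f) = f"
proof (rule fls_eqI)
  fix n
  show "Par (Par f) $$ n = f $$ n"
    by (rule decompose_R[of "f $$ n"]) (use par_eq par_eq[OF _ R1_uminus] in force)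
qed

lemma v_inv_v: "v_inv * v = 1"
  by (metis v_inv E0_central[OF v_E0])

lemma \<phi>_add: "\<phi> (sadd x y) = sadd (\<phi> x) (\<phi> y)"
  by (simp add: \<phi>_def sadd_def T_plus algebra_simps)

lemma \<phi>_const: "\<phi> (sconst c) = sconst c"
  by (simp add: \<phi>_def sconst_def T_const T_0)

text \<open>Moving \<eta> to the left turns a factor into its \<open>Par\<close>, matching the sign
  rule in \<open>smult\<close>; the \<eta>-terms of the second component assemble into T (f h)' by
  the Leibniz rule.\<close>

lemma \<phi>_mult: "\<phi> (smult R0 R1 x y) = smult R0 R1 (\<phi> x) (\<phi> y)"
proof -
  obtain f g h k where [simp]: "x = (f, g)" "y = (h, k)" by (metis surj_pair)
  have \<eta>: "Par (T f + \<eta> * T g) = Par (T f) - \<eta> * Par (T g)"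
    by (simp add: Par_add Par_mult Par_E1[OF \<eta>_E1])
  have 1: "(T f + \<eta> * T g) * (T h + \<eta> * T k) = T f * T h + \<eta> * (Par (T f) * T k + T g * T h)"
    by (simp add: distrib_left distrib_right mult.assoc mult_\<eta>[of "T f"] mult_\<eta>[of "T g"] \<eta>_\<eta>)
  have 2: "(Par (T f) - \<eta> * Par (T g)) * (\<eta> * T (fls_deriv h) + T k) + (\<eta> * T (fls_deriv f) + T g) * (T h + \<eta> * T k)
      = \<eta> * (T f * T (fls_deriv h) + T (fls_deriv f) * T h) + Par (T f) * T k + T g * T h"
    by (simp add: distrib_left distrib_right left_diff_distrib mult.assoc mult_\<eta>[of "Par (T f)"] Par_Par
        mult_\<eta>[of "Par (T g)"] mult_\<eta>[of "T g"] mult_\<eta>[of "T (fls_deriv f)"] \<eta>_\<eta>)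
  have 3: "(Par (T f) - \<eta> * Par (T g)) * (v * (\<eta> * T (fls_deriv h) + T k)) +
      v * (\<eta> * T (fls_deriv f) + T g) * (T h + \<eta> * T k) =
      v * (\<eta> * (T f * T (fls_deriv h) + T (fls_deriv f) * T h) + Par (T f) * T k + T g * T h)"
    unfolding mult_v mult.assoc[of v] 2[symmetric] by (simp only: distrib_left[of v])
  show ?thesis
    by (simp add: smult_def \<phi>_def \<eta> 1 3 T_plus T_mult flip: T_Par) (simp only: add.assoc)
qed

lemma \<phi>_\<phi>_inv: "\<phi> (\<phi>_inv x) = x"
proof -
  have "v * (v_inv * snd x) = snd x" using v_inv by (simp flip: mult.assoc)
  then show ?thesis
    by (simp add: \<phi>_def \<phi>_inv_def Let_def right_diff_distrib \<eta>_\<eta>)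
qed

lemma \<phi>_inv_\<phi>: "\<phi>_inv (\<phi> x) = x"
proof -
  have "v_inv * (v * y) = y" for y using v_inv_v by (simp flip: mult.assoc)
  then show ?thesis
    by (simp add: \<phi>_def \<phi>_inv_def Let_def distrib_left \<eta>_\<eta>)
qed

lemma bij_\<phi>: "bij \<phi>"
  by (rule o_bij[of \<phi>_inv]) (auto simp: \<phi>_\<phi>_inv \<phi>_inv_\<phi>)

lemma inv_\<phi>: "inv \<phi> = \<phi>_inv"
  by (rule inv_unique_comp) (auto simp: \<phi>_\<phi>_inv \<phi>_inv_\<phi>)

lemma zcont_\<phi>: "zcont \<phi>"
  by (rule zcontI[OF \<phi>_add]) (auto simp: \<phi>_def T_0 intro!: fls_contadd_intros fls_contadd_T)

lemma zcont_\<phi>_inv: "zcont \<phi>_inv"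
proof (rule zcontI)
  fix x y
  have "\<phi> (sadd (\<phi>_inv x) (\<phi>_inv y)) = sadd x y" by (simp add: \<phi>_add \<phi>_\<phi>_inv)
  then show "\<phi>_inv (sadd x y) = sadd (\<phi>_inv x) (\<phi>_inv y)" by (metis \<phi>_inv_\<phi>)
next
  have 0: "fls_contadd (\<lambda>f :: 'a fls. 0 :: 'a fls)"
    using fls_contadd_diff[OF fls_contadd_id fls_contadd_id] by simp
  note intros = fls_contadd_intros fls_contadd_S fls_contadd_T 0
  show "fls_contadd (\<lambda>f. fst (\<phi>_inv (f, 0)))" "fls_contadd (\<lambda>f. snd (\<phi>_inv (f, 0)))"
    "fls_contadd (\<lambda>g. fst (\<phi>_inv (0, g)))" "fls_contadd (\<lambda>g. snd (\<phi>_inv (0, g)))"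
    unfolding \<phi>_inv_def Let_def fst_conv snd_conv by (intro intros)+
qed

text \<open>The factor must be D of the image of \<zeta>, as D \<zeta> = 1.\<close>

lemma sD_\<phi>: "sD (\<phi> x) = smult R0 R1 (v, fls_deriv \<eta>) (\<phi> (sD x))"
proof -
  obtain f g where [simp]: "x = (f, g)" by (metis surj_pair)
  let ?f = "T (fls_deriv f)" and ?g = "T (fls_deriv g)"
  let ?u' = "fls_deriv u" and ?\<eta>' = "fls_deriv \<eta>"
  have u': "x * ?u' = ?u' * x" for x by (rule E0_central[OF E0_deriv[OF u_E0], symmetric])
  have \<eta>': "?\<eta>' * (\<eta> * x) = - (\<eta> * (?\<eta>' * x))" for x
    using E1_anticommute[OF \<eta>_E1 E1_deriv[OF \<eta>_E1]] by (simp flip: mult.assoc)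
  \<comment> \<open>Here the quadratic relation for \<open>v\<close> enters; its summand \<eta>
    \<eta>' annihilates the part divisible by \<eta>.\<close>
  have "v * (v * (\<eta> * ?g + ?f)) = (?u' + \<eta> * ?\<eta>') * (\<eta> * ?g + ?f)"
    by (simp add: v_square flip: mult.assoc)
  also have "\<dots> = ?u' * (\<eta> * ?g) + ?u' * ?f + \<eta> * (?\<eta>' * ?f)"
    by (simp add: distrib_left distrib_right mult.assoc \<eta>' \<eta>_\<eta>)
  finally have vv: "v * (v * (\<eta> * ?g + ?f)) = ?u' * (\<eta> * ?g) + ?u' * ?f + \<eta> * (?\<eta>' * ?f)" .
  have "fls_deriv (T f + \<eta> * T g) = ?u' * ?f + (?u' * (\<eta> * ?g) + ?\<eta>' * T g)"
    by (simp add: T_deriv u' flip: mult.assoc)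
  also have "\<dots> = v * (v * (\<eta> * ?g + ?f)) + ?\<eta>' * (T g + \<eta> * ?f)"
    unfolding vv by (simp add: distrib_left \<eta>')
  finally show ?thesis
    by (simp add: sD_def \<phi>_def smult_def Par_E0[OF v_E0] add.commute)
qed

lemma \<phi>_SWitt: "\<phi> \<in> SWitt R0 R1"
proof -
  have "seven R0 R1 (\<phi> x)" if "seven R0 R1 x" for x
    using that \<eta>_E1 v_E0 unfolding seven_iff \<phi>_def fst_conv snd_conv
    by (blast intro: E0_add E1_add E11_mult E01_mult E10_mult T_E0 T_E1 E0_deriv)
  moreover have "sodd R0 R1 (\<phi> x)" if "sodd R0 R1 x" for x
    using that \<eta>_E1 v_E0 unfolding sodd_iff \<phi>_def fst_conv snd_conv
    by (blast intro: E0_add E1_add E0_mult E11_mult E01_mult E10_mult T_E0 T_E1 E1_deriv)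
  \<comment> \<open>\<open>SWitt\<close> applies the inverse after D, so the conformal factor has to
    be pulled back.\<close>
  moreover have "inv \<phi> (sD (\<phi> x)) = smult R0 R1 (\<phi>_inv (v, fls_deriv \<eta>)) (sD x)" for x
    unfolding inv_\<phi> by (metis sD_\<phi> \<phi>_mult \<phi>_\<phi>_inv \<phi>_inv_\<phi>)
  moreover have "zcont (inv \<phi>)" by (simp add: inv_\<phi> zcont_\<phi>_inv)
  ultimately show ?thesis
    using bij_\<phi> \<phi>_add \<phi>_mult \<phi>_const zcont_\<phi> unfolding SWitt_def by blast
qed

lemma psi_\<phi>: "psi \<phi> = ((u, \<eta>), v)"
  by (simp add: psi_def \<phi>_def sz_def szeta_def T_X T_0 T_1)

end

section \<open>Surjectivity\<close>

text \<open>z^k lies in the \<open>k\<close>-th power of a nilpotent ideal; this stands in for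
  binomial expansions when nilpotents are added.\<close>

lemma nilpotent_of_ideal_pow:
  assumes "finite A" and central: "\<And>a x. a \<in> A \<Longrightarrow> a * x = x * a"
    and "\<And>a. a \<in> A \<Longrightarrow> \<exists>k. a ^ k = 0" and z: "ideal_pow A 1 z"
  shows "\<exists>k. z ^ k = 0"
proof -
  obtain L where L: "\<forall>x. ideal_pow A L x \<longrightarrow> x = 0"
    using ideal_pow_nilpotent[OF assms(1-3)] by blast
  have "ideal_pow A k (z ^ k)" for k
  proof (induction k)
    case (Suc k)
    from ideal_pow_mult[OF central z this] show ?case by simp
  qed (simp add: ideal_pow.base)
  then show ?thesis using L by blast
qed

section \<open>Nilpotent even scalars, and surjectivity\<close>

context supercommutative_ring
begin

definition Nil :: "'a set" where "Nil = {x \<in> R0. \<exists>k::nat. x ^ k = 0}"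

lemma Nil_R0: "x \<in> Nil \<Longrightarrow> x \<in> R0"
  by (simp add: Nil_def)

lemma Nil_0: "0 \<in> Nil"
  unfolding Nil_def by (simp add: exI[of _ "1 :: nat"])

lemma Nil_add:
  assumes "x \<in> Nil" "y \<in> Nil"
  shows "x + y \<in> Nil"
proof -
  have "ideal_pow {x, y} 1 (x * 1 + (y * 1 + 0))"
    unfolding One_nat_def by (intro ideal_pow.intros) simp_all
  then have "ideal_pow {x, y} 1 (x + y)" by simp
  moreover have "a * z = z * a" if "a \<in> {x, y}" for a z
    using that assms by (intro R0_central) (auto dest: Nil_R0)
  moreover have "\<exists>k. a ^ k = 0" if "a \<in> {x, y}" for a
    using that assms unfolding Nil_def by blast
  ultimately have "\<exists>k. (x + y) ^ k = 0"
    using nilpotent_of_ideal_pow[of "{x, y}" "x + y"] by blast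
  then show ?thesis using assms by (simp add: Nil_def R0_add)
qed

lemma Nil_mult:
  assumes "x \<in> Nil" "y \<in> R0"
  shows "x * y \<in> Nil"
proof -
  have "(x * y) ^ k = x ^ k * y ^ k" for k
  proof (induction k)
    case (Suc k)
    have "y * x ^ k = x ^ k * y"
      by (rule R0_central[OF R0_power[OF Nil_R0[OF assms(1)]], symmetric])
    then have "x * (y * x ^ k) * y ^ k = x * (x ^ k * y) * y ^ k" by (rule arg_cong)
    then show ?case using Suc by (simp add: mult.assoc)
  qed simp
  moreover obtain k where "x ^ k = 0" using assms(1) unfolding Nil_def by blast
  ultimately have "(x * y) ^ k = 0" by simp
  then show ?thesis using assms R0_mult unfolding Nil_def by blast
qed

lemma Nil_uminus: "x \<in> Nil \<Longrightarrow> - x \<in> Nil"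
  using Nil_mult[of x "-1"] by (simp add: R0_uminus)

lemma Nil_sum: "(\<And>i. i \<in> I \<Longrightarrow> f i \<in> Nil) \<Longrightarrow> sum f I \<in> Nil"
  by (induction I rule: infinite_finite_induct) (simp_all add: Nil_0 Nil_add)

lemma Nil_R1_mult:
  assumes "x \<in> R1" "y \<in> R1"
  shows "x * y \<in> Nil"
proof -
  have "(x * y) ^ 2 = x * (y * x) * y" by (simp add: power2_eq_square mult.assoc)
  also have "y * x = - (x * y)" using assms by (simp only: R1_anticommute[of y x])
  also have "x * - (x * y) * y = - (x * x * (y * y))" by (simp add: mult.assoc)
  also have "\<dots> = 0" using assms(1) by (simp add: R1_square)
  finally show ?thesis using assms unfolding Nil_def by (blast intro: R11_mult)
qed

lemma Nil_E1_mult: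
  assumes "f \<in> E1" "g \<in> E1"
  shows "(f * g) $$ n \<in> Nil"
  unfolding fls_times_nth(2)
  by (rule Nil_sum) (use assms in \<open>simp add: E1_def Nil_R1_mult\<close>)

text \<open>Finite geometric series in the nilpotent 1 - x y.\<close>

lemma unit_mod_Nil:
  assumes "x \<in> R0" "y \<in> R0" "1 - x * y \<in> Nil"
  obtains z where "z \<in> R0" "x * z = 1" "z * x = 1"
proof -
  obtain k where k: "(1 - x * y) ^ k = 0" using assms(3) by (auto simp: Nil_def)
  let ?s = "\<Sum>i<k. (1 - x * y) ^ i"
  have "x * y * (\<Sum>i<n. (1 - x * y) ^ i) = 1 - (1 - x * y) ^ n" for n
  proof (induction n)
    case (Suc n)
    then show ?case by (simp add: algebra_simps)
  qed simp
  from this[of k] have "x * (y * ?s) = 1" using k by (simp add: mult.assoc)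
  moreover have "y * ?s \<in> R0"
    using assms by (intro R0_mult R0_sum R0_power) (auto simp: R0_diff R0_mult)
  moreover have "(y * ?s) * x = x * (y * ?s)" using R0_central[OF assms(1)] by simp
  ultimately show ?thesis by (intro that) simp_all
qed

lemma Gamma1_iff: "x \<in> Gamma1 R0 R1 \<longleftrightarrow> fst x \<in> coords \<and> snd x \<in> E1"
  by (auto simp: Gamma1_def coords_def seven_def E0_def E1_def)

lemma coords_Nil: "u \<in> coords \<Longrightarrow> n < 1 \<Longrightarrow> u $$ n \<in> Nil"
  by (simp add: coords_def Nil_def E0_def)

text \<open>Products of odd scalars are nilpotent, so \<eta> \<eta>' changes every coefficient only
  by a nilpotent. The factor z moves the coefficient a_1 of u' back to degree 1, and degree n < 1
  carries n a_n.\<close>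

lemma deriv_perturbation_coords:
  assumes u: "u \<in> coords" and \<eta>: "\<eta> \<in> E1"
  shows "fls_X * (fls_deriv u + \<eta> * fls_deriv \<eta>) \<in> coords"
proof -
  let ?f = "fls_X * (fls_deriv u + \<eta> * fls_deriv \<eta>)"
  have f_nth: "?f $$ n = of_int n * u $$ n + (\<eta> * fls_deriv \<eta>) $$ (n - 1)" for n
    by (simp add: fls_X_times_conv_shift)
  have nil: "(\<eta> * fls_deriv \<eta>) $$ n \<in> Nil" for n
    by (rule Nil_E1_mult[OF \<eta> E1_deriv[OF \<eta>]])
  have u_E0: "u \<in> E0" using u by (simp add: coords_def)
  have f_E0: "?f \<in> E0"
    by (intro E0_mult E0_X E0_add E0_deriv E11_mult E1_deriv u_E0 \<eta>)
  obtain b where b: "b \<in> R0" "u $$ 1 * b = 1" using u unfolding coords_def by blast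
  have "1 - ?f $$ 1 * b = - ((\<eta> * fls_deriv \<eta>) $$ 0 * b)"
    by (simp add: f_nth distrib_right b(2))
  then have "1 - ?f $$ 1 * b \<in> Nil"
    using Nil_uminus[OF Nil_mult[OF nil b(1)]] by simp
  then obtain z where "z \<in> R0" "?f $$ 1 * z = 1" "z * ?f $$ 1 = 1"
    using unit_mod_Nil[of "?f $$ 1" b] f_E0 b(1) unfolding E0_def by blast
  moreover have "?f $$ n \<in> Nil" if "n < 1" for n
  proof -
    have "of_int n * u $$ n = u $$ n * of_int n" by (simp add: mult_of_int_commute)
    then show ?thesis
      unfolding f_nth using coords_Nil[OF u that] nil by (simp add: Nil_add Nil_mult R0_of_int)
  qed
  ultimately show ?thesis using f_E0 unfolding coords_def Nil_def by blast
qed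

lemma psi_surj:
  assumes "p \<in> GammaT R0 R1"
  shows "\<exists>\<phi>\<in>SWitt R0 R1. psi \<phi> = p"
proof -
  obtain u \<eta> v where p: "p = ((u, \<eta>), v)" by (metis surj_pair)
  have u: "u \<in> coords" and \<eta>: "\<eta> \<in> E1" and v: "v \<in> E0"
    and vv: "v * v = fls_deriv u + \<eta> * fls_deriv \<eta>"
    using assms by (simp_all add: GammaT_def p Gamma1_iff E0_def power2_eq_square)
  have u_E0: "u \<in> E0" using u by (simp add: coords_def)
  obtain w where w: "w \<in> E0" "u * w = 1" using u by (rule coords_inverse)
  obtain x where x: "x \<in> E0" "fls_X * (v * v) * x = 1"
    using deriv_perturbation_coords[OF u \<eta>] unfolding vv[symmetric] by (rule coords_inverse)
  \<comment> \<open>An inverse \<open>x\<close> of z v^2 yields the inverse z v x of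
    \<open>v\<close>.\<close>
  have "v * (fls_X * v * x) = v * fls_X * v * x" by (simp only: mult.assoc)
  also have "v * fls_X = fls_X * v" by (rule E0_central[OF v])
  finally have v_inv: "v * (fls_X * v * x) = 1" using x(2) by (simp only: mult.assoc)
  obtain b where b: "b \<in> R0" "u $$ 1 * b = 1" "b * u $$ 1 = 1" using u unfolding coords_def by blast
  obtain J C where J: "fls_filtration J C" "u - fls_monom (u $$ 1) 1 \<in> fls_filtration.F J 2"
    using u by (rule coords_filtration)
  interpret fls_filtration J C by (rule J(1))
  interpret superconformal_change R0 R1 J C u w "u $$ 1" b \<eta> v "fls_X * v * x"
  proof
    show "fls_X * v * x \<in> E0" by (intro E0_mult E0_X v x(1))
  qed (fact u_E0 J(2) b w \<eta> v v_inv vv)+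
  show ?thesis using \<phi>_SWitt psi_\<phi> p by blast
qed

end

section \<open>Automorphisms yield pairs\<close>

context supercommutative_ring
begin

lemma smult_assoc: "smult R0 R1 (smult R0 R1 x y) z = smult R0 R1 x (smult R0 R1 y z)"
  by (simp add: smult_def Par_mult distrib_left distrib_right mult.assoc add.assoc)

lemma smult_1: "smult R0 R1 x (sconst 1) = x" "smult R0 R1 (sconst 1) x = x"
proof -
  have "Par 1 = 1" by (rule Par_E0) simp
  then show "smult R0 R1 x (sconst 1) = x" "smult R0 R1 (sconst 1) x = x"
    by (simp_all add: smult_def sconst_def)
qed

lemma smult_even: "smult R0 R1 (f, 0) (g, 0) = (f * g, 0)"
  by (simp add: smult_def)

lemma smult_szeta: "smult R0 R1 szeta (f, 0) = (0, f)"
proof -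
  have "Par 0 = 0" by (rule Par_E0) simp
  then show ?thesis by (simp add: smult_def szeta_def)
qed

text \<open>With m = c z^lo, each factor u - m is expanded into one more \<open>u\<close> or one
  more \<open>m\<close>. At the end either m^i = 0, or fewer than K factors \<open>m\<close> remain
  and \<open>j\<close> exceeds N; the shift by K lo in the hypothesis pays for the poles of these
  factors.\<close>

lemma power_mult_above:
  assumes u: "u \<in> E0" and u_lim: "\<And>j. N \<le> j \<Longrightarrow> u ^ j \<in> fls_above (M - int K * lo)"
    and lo: "lo \<le> 0" and c: "c \<in> R0" "c ^ K = 0" and ijn: "N + K \<le> i + j + n"
  shows "(u - fls_monom c lo) ^ n * (fls_monom c lo ^ i * u ^ j) \<in> fls_above M"
  using ijn
proof (induction n arbitrary: i j)
  case 0
  let ?m = "fls_monom c lo"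
  have m_pow: "?m ^ i = fls_monom (c ^ i) (int i * lo)" for i
    by (induction i) (simp_all add: fls_one_conv_monom algebra_simps)
  show ?case
  proof (cases "K \<le> i")
    case True
    then have "c ^ i = c ^ K * c ^ (i - K)" by (simp flip: power_add)
    then show ?thesis using c(2) by (simp add: m_pow fls_above_def)
  next
    case False
    have "?m ^ i \<in> fls_above (int i * lo)" by (simp add: m_pow fls_monom_above)
    moreover have "int K * lo \<le> int i * lo" using False lo by (intro mult_right_mono_neg) auto
    ultimately have "?m ^ i \<in> fls_above (int K * lo)" by (rule fls_above_mono)
    then have "?m ^ i * u ^ j \<in> fls_above (int K * lo + (M - int K * lo))"
      using False 0 by (intro fls_above_mult u_lim) auto
    then show ?thesis by simp
  qed
next
  case (Suc n)
  let ?m = "fls_monom c lo"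
  let ?d = "u - ?m"
  have "?d * (?m ^ i * u ^ j) = u * ?m ^ i * u ^ j - ?m * ?m ^ i * u ^ j"
    by (simp only: left_diff_distrib mult.assoc)
  also have "u * ?m ^ i = ?m ^ i * u" by (rule E0_central[OF u])
  finally have "?d * (?m ^ i * u ^ j) = ?m ^ i * u ^ Suc j - ?m ^ Suc i * u ^ j"
    by (simp add: mult.assoc)
  then have "?d ^ Suc n * (?m ^ i * u ^ j) = ?d ^ n * (?m ^ i * u ^ Suc j) - ?d ^ n * (?m ^ Suc i * u ^ j)"
    using right_diff_distrib[of "?d ^ n"] by (metis power_Suc2 mult.assoc)
  then show ?case
    using Suc.IH[of i "Suc j"] Suc.IH[of "Suc i" j] Suc.prems by (simp only: fls_above_diff)
qed

lemma power_nth_lowest: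
  fixes f :: "'a fls"
  assumes "f \<in> fls_above lo"
  shows "(f ^ n) $$ (int n * lo) = (f $$ lo) ^ n"
proof -
  have pow: "f ^ n \<in> fls_above (int n * lo)" for n
  proof (induction n)
    case (Suc n)
    from fls_above_mult[OF assms this] show ?case by (simp add: algebra_simps)
  qed (simp add: fls_above_def)
  show ?thesis
  proof (induction n)
    case (Suc n)
    have "(f * f ^ n) $$ (lo + int n * lo) = f $$ lo * f ^ n $$ (int n * lo)"
      by (simp add: fls_times_nth_above[OF assms pow])
    then show ?case using Suc by (simp add: algebra_simps)
  qed simp
qed

text \<open>The lowest coefficient is nilpotent because its powers are the lowest coefficients of the
  powers; peeling it off preserves the hypothesis.\<close>

lemma nilpotent_nth_of_powers_vanish:
  assumes "u \<in> E0" "\<And>M. \<exists>N. \<forall>n\<ge>N. u ^ n \<in> fls_above M" "m < 1"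
  shows "u $$ m \<in> Nil"
proof -
  have "u $$ m \<in> Nil"
    \<comment> \<open>The induction variable \<open>k\<close> bounds the number of degrees below 1
      that \<open>u\<close> may occupy.\<close>
    if "u \<in> fls_above (1 - int k)" "u \<in> E0" "\<And>M. \<exists>N. \<forall>n\<ge>N. u ^ n \<in> fls_above M" for u k
    using that
  proof (induction k arbitrary: u)
    case 0
    then show ?case using assms(3) fls_aboveD[of u 1 m] by (simp add: Nil_0)
  next
    case (Suc k)
    define lo where "lo = 1 - int (Suc k)"
    define c where "c = u $$ lo"
    have u: "u \<in> fls_above lo" and lo: "lo \<le> 0" using Suc.prems(1) by (simp_all add: lo_def)
    have c: "c \<in> R0" using Suc.prems(2) by (simp add: c_def E0_def)
    \<comment> \<open>u^K has no terms in degrees below 1, yet its coefficient in degree K lo, which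
      is at most 0, is c^K.\<close>
    obtain K where "\<forall>n\<ge>K. u ^ n \<in> fls_above 1" using Suc.prems(3) by blast
    then have "u ^ K \<in> fls_above 1" by simp
    moreover have "int K * lo \<le> 0" using lo by (simp add: mult_nonneg_nonpos)
    ultimately have "(u ^ K) $$ (int K * lo) = 0" by (intro fls_aboveD) auto
    then have cK: "c ^ K = 0" by (simp add: power_nth_lowest[OF u] c_def)
    let ?d = "u - fls_monom c lo"
    have "?d \<in> fls_above (1 - int k)"
    proof (rule fls_aboveI)
      fix n assume "n < 1 - int k"
      then show "?d $$ n = 0" using fls_aboveD[OF u, of n] by (auto simp: c_def lo_def)
    qed
    moreover have "?d \<in> E0" by (intro E0_diff Suc.prems(2) E0_monom c)
    moreover have "\<exists>N. \<forall>n\<ge>N. ?d ^ n \<in> fls_above M" for M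
    proof -
      obtain N where N: "\<forall>j\<ge>N. u ^ j \<in> fls_above (M - int K * lo)" using Suc.prems(3) by blast
      have "?d ^ n \<in> fls_above M" if "N + K \<le> n" for n
        using power_mult_above[OF Suc.prems(2) _ lo c cK, of N M 0 0 n] N that by simp
      then show ?thesis by blast
    qed
    ultimately have "?d $$ m \<in> Nil" by (rule Suc.IH)
    moreover have "c \<in> Nil" using c cK by (auto simp: Nil_def)
    ultimately show ?case
      using Nil_add[of "?d $$ m" c] by (cases "m = lo") simp_all
  qed
  moreover have "u \<in> fls_above (1 - int (nat (1 - fls_subdegree u)))"
    by (rule fls_above_mono[OF fls_above_subdegree]) simp
  ultimately show ?thesis using assms(1,2) by blast
qed

end

section \<open>The coordinates of a given automorphism\<close>

locale superconformal_automorphism = supercommutative_ring R0 R1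
  for R0 R1 :: "'a::ring_1 set" +
  fixes \<phi> :: "'a sls \<Rightarrow> 'a sls"
  assumes SWitt: "\<phi> \<in> SWitt R0 R1"
begin

lemma bij: "bij \<phi>"
  and add: "\<phi> (sadd x y) = sadd (\<phi> x) (\<phi> y)"
  and mult: "\<phi> (smult R0 R1 x y) = smult R0 R1 (\<phi> x) (\<phi> y)"
  and const: "\<phi> (sconst c) = sconst c"
  and even: "seven R0 R1 x \<Longrightarrow> seven R0 R1 (\<phi> x)"
  and odd: "sodd R0 R1 x \<Longrightarrow> sodd R0 R1 (\<phi> x)"
  and cont: "zcont \<phi>" "zcont (inv \<phi>)"
  and conformal: "\<exists>F. \<forall>x. inv \<phi> (sD (\<phi> x)) = smult R0 R1 F (sD x)"
  using SWitt unfolding SWitt_def mem_Collect_eq by blast+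

abbreviation u :: "'a fls" where "u \<equiv> fst (\<phi> sz)"
abbreviation \<omega> :: "'a fls" where "\<omega> \<equiv> snd (\<phi> sz)"
abbreviation \<eta> :: "'a fls" where "\<eta> \<equiv> fst (\<phi> szeta)"
abbreviation v :: "'a fls" where "v \<equiv> snd (\<phi> szeta)"

lemma parity: "u \<in> E0" "\<omega> \<in> E1" "\<eta> \<in> E1" "v \<in> E0"
  using even[of sz] odd[of szeta] by (simp_all add: seven_iff sodd_iff sz_def szeta_def)

lemma zero: "\<phi> (0, 0) = (0, 0)"
  using const[of 0] by (simp add: sconst_def)

lemma fls_contadd_restrict:
  "fls_contadd (\<lambda>f. fst (\<phi> (f, 0)))" "fls_contadd (\<lambda>f. snd (\<phi> (f, 0)))"
proof -
  have "\<phi> (f + g, 0) = sadd (\<phi> (f, 0)) (\<phi> (g, 0))" for f g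
    using add[of "(f, 0)" "(g, 0)"] by (simp add: sadd_def)
  moreover have "\<exists>N. \<forall>f\<in>fls_above N. \<phi> (f, 0) \<in> zadic M" for M
  proof -
    obtain N where "\<phi> ` zadic N \<subseteq> zadic M" using cont(1) unfolding zcont_def by blast
    moreover have "(f, 0) \<in> zadic N" if "f \<in> fls_above N" for f :: "'a fls"
      using that by (simp add: zadic_iff fls_above_def)
    ultimately show ?thesis by blast
  qed
  ultimately show "fls_contadd (\<lambda>f. fst (\<phi> (f, 0)))" "fls_contadd (\<lambda>f. snd (\<phi> (f, 0)))"
    unfolding fls_contadd_def zadic_iff by (simp_all add: sadd_def) meson+
qed

text \<open>D \<zeta> = 1 identifies the conformal factor as (v, \<eta>'); D z = \<zeta> then gives
  both equations, one per component.\<close>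

lemma conformal_equations: "\<omega> = v * \<eta>" "v ^ 2 = fls_deriv u + \<eta> * fls_deriv \<eta>"
proof -
  obtain F where F: "\<And>x. inv \<phi> (sD (\<phi> x)) = smult R0 R1 F (sD x)"
    using conformal by blast
  have D: "sD (\<phi> x) = smult R0 R1 (\<phi> F) (\<phi> (sD x))" for x
  proof -
    have "sD (\<phi> x) = \<phi> (inv \<phi> (sD (\<phi> x)))" using bij by (simp add: bij_is_surj surj_f_inv_f)
    then show ?thesis by (simp add: F mult)
  qed
  have "sD szeta = (sconst 1 :: 'a sls)" by (simp add: sD_def szeta_def sconst_def)
  then have F': "\<phi> F = (v, fls_deriv \<eta>)"
    using D[of szeta] by (simp add: const smult_1) (simp add: sD_def)
  have "sD sz = (szeta :: 'a sls)" by (simp add: sD_def szeta_def sz_def)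
  then have *: "(\<omega>, fls_deriv u) = (v * \<eta>, v * v + fls_deriv \<eta> * \<eta>)"
    using D[of sz] parity(4) by (simp add: F' smult_def sD_def Par_E0)
  then show "\<omega> = v * \<eta>" by simp
  have "fls_deriv \<eta> * \<eta> = - (\<eta> * fls_deriv \<eta>)"
    by (rule E1_anticommute[OF parity(3) E1_deriv[OF parity(3)]])
  then show "v ^ 2 = fls_deriv u + \<eta> * fls_deriv \<eta>"
    using * by (simp add: power2_eq_square)
qed

lemma powers_vanish: "\<exists>N. \<forall>n\<ge>N. u ^ n \<in> fls_above M"
proof -
  \<comment> \<open>Setting \<zeta> = 0 is multiplicative, so first components of powers are powers
    of \<open>u\<close>.\<close>
  have pow: "fst (\<phi> (fls_X ^ n, 0)) = u ^ n" for n
  proof (induction n)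
    case 0
    then show ?case using const[of 1] by (simp add: sconst_def)
  next
    case (Suc n)
    have "(fls_X ^ Suc n, 0) = smult R0 R1 sz (fls_X ^ n, 0)" by (simp add: sz_def smult_even)
    then show ?case using Suc by (simp add: mult) (simp add: smult_def)
  qed
  obtain N where N: "\<forall>f\<in>fls_above N. fst (\<phi> (f, 0)) \<in> fls_above M"
    using fls_contadd_restrict(1) unfolding fls_contadd_def by blast
  have "u ^ n \<in> fls_above M" if "nat N \<le> n" for n
  proof -
    have "fls_X ^ n \<in> fls_above N" using that by (auto simp: fls_above_def)
    then show ?thesis unfolding pow[symmetric] using N by blast
  qed
  then show ?thesis by blast
qed

lemma u_Nil: "n < 1 \<Longrightarrow> u $$ n \<in> Nil"
  by (rule nilpotent_nth_of_powers_vanish[OF parity(1) powers_vanish])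

text \<open>\<open>SWitt\<close> states parity only for \<phi>. The odd part of the preimage has an
  image that is odd, but also even as a difference of even elements, hence 0; injectivity removes
  it.\<close>

lemma inv_even:
  assumes "seven R0 R1 x"
  shows "seven R0 R1 (inv \<phi> x)"
proof -
  obtain f g where fg: "inv \<phi> x = (f, g)" by (rule prod.exhaust)
  then have x: "\<phi> (f, g) = x" using bij by (metis bij_inv_eq_iff)
  have ev0: "ev 0 = 0" by (simp add: ev_R0)
  let ?f = "fls_map ev f" and ?g = "fls_map ev g"
  have E: "?f \<in> E0" "f - ?f \<in> E1" "?g \<in> E0" "g - ?g \<in> E1"
    by (simp_all add: E0_def E1_def fls_map_nth ev0 ev_in_R0 diff_ev_in_R1)
  have e: "seven R0 R1 (\<phi> (?f, g - ?g))" and o: "sodd R0 R1 (\<phi> (f - ?f, ?g))"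
    by (intro even odd; simp add: seven_iff sodd_iff E)+
  have "sadd (\<phi> (?f, g - ?g)) (\<phi> (f - ?f, ?g)) = x"
    unfolding add[symmetric] by (simp add: sadd_def x)
  then have "fst (\<phi> (f - ?f, ?g)) = fst x - fst (\<phi> (?f, g - ?g))"
    "snd (\<phi> (f - ?f, ?g)) = snd x - snd (\<phi> (?f, g - ?g))"
    by (auto simp: sadd_def)
  then have "fst (\<phi> (f - ?f, ?g)) \<in> E0" "snd (\<phi> (f - ?f, ?g)) \<in> E1"
    using e assms by (auto simp: seven_iff E0_def E1_def R0_diff R1_diff)
  then have "fst (\<phi> (f - ?f, ?g)) = 0" "snd (\<phi> (f - ?f, ?g)) = 0"
    using o by (auto simp: sodd_iff E0_def E1_def intro!: fls_zero_eqI R0_Int_R1)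
  then have "\<phi> (f - ?f, ?g) = \<phi> (0, 0)" by (simp add: zero prod_eq_iff)
  then have "(f - ?f, ?g) = (0, 0)" using bij by (simp add: bij_is_inj inj_eq)
  then have "f = ?f" "?g = 0" by simp_all
  then show ?thesis using E unfolding fg seven_iff by auto
qed

lemma inv_Nil:
  assumes "n < 1"
  shows "fst (inv \<phi> sz) $$ n \<in> Nil"
proof (rule nilpotent_nth_of_powers_vanish[OF _ _ assms])
  let ?\<psi> = "inv \<phi>" and ?w = "fst (inv \<phi> sz)"
  have \<psi>: "?\<psi> (\<phi> x) = x" "\<phi> (?\<psi> x) = x" for x
    using bij by (simp_all add: bij_is_inj bij_is_surj inv_f_f surj_f_inv_f)
  have "seven R0 R1 (sz :: 'a sls)" by (simp add: seven_iff sz_def)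
  then show "?w \<in> E0" using inv_even seven_iff by blast
  have pow: "fst (?\<psi> (fls_X ^ n, 0)) = ?w ^ n" for n
  proof (induction n)
    case 0
    then show ?case using \<psi>(1)[of "sconst 1"] const[of 1] by (simp add: sconst_def)
  next
    case (Suc n)
    have "(fls_X ^ Suc n, 0) = smult R0 R1 sz (fls_X ^ n, 0)" by (simp add: sz_def smult_even)
    also have "\<dots> = \<phi> (smult R0 R1 (?\<psi> sz) (?\<psi> (fls_X ^ n, 0)))" by (simp only: mult \<psi>)
    finally have "?\<psi> (fls_X ^ Suc n, 0) = smult R0 R1 (?\<psi> sz) (?\<psi> (fls_X ^ n, 0))"
      by (simp only: \<psi>)
    then show ?case using Suc by (simp add: smult_def)
  qed
  fix M
  obtain N where N: "?\<psi> ` zadic N \<subseteq> zadic M" using cont(2) unfolding zcont_def by blast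
  have "?w ^ n \<in> fls_above M" if "nat N \<le> n" for n
  proof -
    have "(fls_X ^ n, 0) \<in> zadic N" using that by (auto simp: zadic_iff fls_above_def)
    then show ?thesis unfolding pow[symmetric] using N zadic_iff by blast
  qed
  then show "\<exists>N. \<forall>n\<ge>N. ?w ^ n \<in> fls_above M" by blast
qed

text \<open>Modulo nilpotents \<open>u\<close> starts in degree 1, so u^n starts in degree
  n.\<close>

lemma u_power_Nil: "m < int n \<Longrightarrow> (u ^ n) $$ m \<in> Nil"
proof (induction n arbitrary: m)
  case (Suc n)
  have "u $$ i * (u ^ n) $$ (m - i) \<in> Nil" for i
  proof (cases "i < 1")
    case True
    then show ?thesis
      using u_Nil E0_power[OF parity(1), of n] by (auto simp: E0_def intro: Nil_mult)
  next
    case False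
    then have "(u ^ n) $$ (m - i) \<in> Nil" using Suc by auto
    moreover have ui: "u $$ i \<in> R0" using parity(1) by (simp add: E0_def)
    ultimately have "(u ^ n) $$ (m - i) * u $$ i \<in> Nil" by (rule Nil_mult)
    then show ?thesis by (simp only: R0_central[OF ui])
  qed
  then show ?case by (simp add: fls_times_nth(2) Nil_sum)
qed (simp add: Nil_0)

text \<open>Comparing coefficients of \<open>z\<close> in \<open>z = \<phi> (\<phi>\<^sup>-\<^sup>1 z)\<close> modulo nilpotents.\<close>

lemma u_coords: "u \<in> coords"
proof -
  obtain w \<kappa> where w\<kappa>: "inv \<phi> sz = (w, \<kappa>)" by (rule prod.exhaust)
  have "seven R0 R1 (sz :: 'a sls)" by (simp add: seven_iff sz_def)
  then have parity': "w \<in> E0" "\<kappa> \<in> E1" using inv_even[of sz] by (simp_all add: seven_iff w\<kappa>)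
  define A where "A = (\<lambda>f. fst (\<phi> (f, 0)))"
  have A: "fls_contadd A" unfolding A_def by (rule fls_contadd_restrict)
  \<comment> \<open>\<open>U n\<close> is the image of z^n modulo \<zeta>. It stands in for u^n when
    n < 0, where only its evenness is used, since the inverse of \<open>u\<close> is not yet at
    hand.\<close>
  define U where "U = (\<lambda>n. A (fls_monom 1 n))"
  have A_monom: "A (fls_monom c n) = fls_const c * U n" for c n
  proof -
    have "(fls_monom c n, 0) = smult R0 R1 (sconst c) (fls_monom 1 n, 0)"
      by (simp add: sconst_def smult_even fls_const_conv_monom)
    then show ?thesis by (simp add: A_def U_def mult const) (simp add: smult_def sconst_def)
  qed
  have U_E0: "U n \<in> E0" for n
    using even[of "(fls_monom 1 n, 0)"] by (simp add: U_def A_def seven_iff E0_monom)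
  have U_power: "U (int n) = u ^ n" for n
  proof (induction n)
    case 0
    then show ?case using const[of 1] by (simp add: U_def A_def sconst_def fls_one_conv_monom)
  next
    case (Suc n)
    have "(fls_monom 1 (int (Suc n)), 0) = smult R0 R1 sz (fls_monom 1 (int n), 0)"
      by (simp add: sz_def smult_even fls_X_conv_monom)
    then show ?case using Suc by (simp add: U_def A_def mult) (simp add: smult_def)
  qed
  have "sz = \<phi> (w, \<kappa>)" using bij w\<kappa> by (metis bij_inv_eq_iff)
  also have "(w, \<kappa>) = sadd (w, 0) (smult R0 R1 szeta (\<kappa>, 0))" by (simp add: smult_szeta sadd_def)
  finally have "sz = sadd (\<phi> (w, 0)) (smult R0 R1 (\<phi> szeta) (\<phi> (\<kappa>, 0)))"
    by (simp only: add mult)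
  from arg_cong[where f = fst, OF this] have z: "fls_X = A w + \<eta> * A \<kappa>"
    by (simp only: A_def sadd_def smult_def sz_def fst_conv)
  let ?w' = "w - fls_monom (w $$ 1) 1"
  have "A w = A ?w' + A (fls_monom (w $$ 1) 1)" using fls_contadd_plus[OF A, of ?w' "fls_monom (w $$ 1) 1"] by simp
  also have "A (fls_monom (w $$ 1) 1) = fls_const (w $$ 1) * u" using U_power[of 1] by (simp add: A_monom)
  finally have "fls_X $$ 1 = A ?w' $$ 1 + w $$ 1 * u $$ 1 + (\<eta> * A \<kappa>) $$ 1" by (simp add: z)
  then have one: "1 - w $$ 1 * u $$ 1 = A ?w' $$ 1 + (\<eta> * A \<kappa>) $$ 1" by (simp add: algebra_simps)
  \<comment> \<open>Away from the linear term every contribution to degree 1 is nilpotent: for n < 0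
    through the coefficient of \<open>w\<close>, for n > 1 through u^n, while z^0 maps to 1.\<close>
  have "?w' $$ n * U n $$ 1 \<in> Nil" for n
  proof -
    consider "n < 0" | "n = 0" | "n = 1" | "n > 1" by linarith
    then show ?thesis
    proof cases
      case 1
      then have "?w' $$ n \<in> Nil" using inv_Nil[of n] by (simp add: w\<kappa>)
      then show ?thesis using U_E0[of n] by (simp add: E0_def Nil_mult)
    next
      case 2
      then show ?thesis using U_power[of 0] by (simp add: Nil_0)
    next
      case 3
      then show ?thesis by (simp add: Nil_0)
    next
      case 4
      then have "U n $$ 1 \<in> Nil" using U_power[of "nat n"] u_power_Nil[of 1 "nat n"] by simp
      moreover have wn: "?w' $$ n \<in> R0" using parity'(1) 4 by (simp add: E0_def)
      ultimately have "U n $$ 1 * ?w' $$ n \<in> Nil" by (rule Nil_mult)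
      then show ?thesis by (simp only: R0_central[OF wn])
    qed
  qed
  then have A_nil: "A (fls_monom (?w' $$ n) n) $$ 1 \<in> Nil" for n by (simp only: A_monom fls_mult_const_nth)
  obtain H where "\<And>lo f. f \<in> fls_above lo \<Longrightarrow>
      A f $$ 1 = (\<Sum>n\<in>{lo..<H}. A (fls_monom (f $$ n) n) $$ 1)"
    using fls_contadd_nth[OF A] by blast
  from this[OF fls_above_subdegree[of ?w']] have "A ?w' $$ 1 \<in> Nil"
    by (simp only:) (rule Nil_sum, rule A_nil)
  moreover have "A \<kappa> \<in> E1"
    using odd[of "(\<kappa>, 0)"] parity'(2) by (simp add: A_def sodd_iff)
  then have "(\<eta> * A \<kappa>) $$ 1 \<in> Nil" by (rule Nil_E1_mult[OF parity(3)])
  ultimately have "1 - w $$ 1 * u $$ 1 \<in> Nil" unfolding one by (rule Nil_add)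
  moreover have R0: "w $$ 1 \<in> R0" "u $$ 1 \<in> R0" using parity(1) parity'(1) by (simp_all add: E0_def)
  ultimately have "1 - u $$ 1 * w $$ 1 \<in> Nil" by (simp only: R0_central[OF R0(2)])
  with R0(2,1) obtain b where "b \<in> R0" "u $$ 1 * b = 1" "b * u $$ 1 = 1"
    by (rule unit_mod_Nil)
  then show ?thesis using parity(1) u_Nil unfolding coords_def Nil_def by blast
qed

lemma psi_in_GammaT: "psi \<phi> \<in> GammaT R0 R1"
  using u_coords parity conformal_equations(2)
  by (simp add: psi_def GammaT_def Gamma1_iff E0_def)

end

section \<open>Bijectivity and naturality\<close>

lemma (in supercommutative_ring) psi_inj: "inj_on psi (SWitt R0 R1)"
proof (rule inj_onI)
  fix \<phi> \<chi> assume \<phi>: "\<phi> \<in> SWitt R0 R1" and \<chi>: "\<chi> \<in> SWitt R0 R1" and eq: "psi \<phi> = psi \<chi>"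
  interpret \<phi>: superconformal_automorphism R0 R1 \<phi> by unfold_locales (rule \<phi>)
  interpret \<chi>: superconformal_automorphism R0 R1 \<chi> by unfold_locales (rule \<chi>)
  have zeta: "\<phi> szeta = \<chi> szeta" using eq by (simp add: psi_def prod_eq_iff)
  \<comment> \<open>\<open>psi\<close> forgets the component \<omega>; the conformal equation
    restores it.\<close>
  have z: "\<phi> sz = \<chi> sz"
    using eq \<phi>.conformal_equations(1) \<chi>.conformal_equations(1) by (simp add: psi_def prod_eq_iff)
  have nonneg: "\<phi> (fls_monom 1 (int n), 0) = \<chi> (fls_monom 1 (int n), 0)" for n
  proof (induction n)
    case 0
    then show ?case using \<phi>.const[of 1] \<chi>.const[of 1] by (simp add: sconst_def fls_one_conv_monom)
  next
    case (Suc n)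
    have "(fls_monom 1 (int (Suc n)), 0) = smult R0 R1 sz (fls_monom 1 (int n), 0)"
      by (simp add: sz_def smult_even fls_X_conv_monom)
    then show ?case by (simp only: \<phi>.mult \<chi>.mult z Suc)
  qed
  have neg: "\<phi> (fls_monom 1 (- int n), 0) = \<chi> (fls_monom 1 (- int n), 0)" for n
  proof -
    let ?a = "(fls_monom 1 (- int n), 0) :: 'a sls" and ?b = "(fls_monom 1 (int n), 0) :: 'a sls"
    have ab: "smult R0 R1 ?a ?b = sconst 1" "smult R0 R1 ?b ?a = sconst 1"
      by (simp_all add: smult_even sconst_def flip: fls_one_conv_monom)
    \<comment> \<open>Uniqueness of inverses: both maps agree on z^n, and \<open>?a\<close> is its
      inverse before applying either map.\<close>
    have "\<phi> ?a = smult R0 R1 (\<phi> ?a) (\<chi> (smult R0 R1 ?b ?a))" by (simp only: ab \<chi>.const smult_1)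
    also have "\<dots> = smult R0 R1 (\<phi> (smult R0 R1 ?a ?b)) (\<chi> ?a)"
      by (simp only: \<phi>.mult \<chi>.mult smult_assoc nonneg)
    also have "\<dots> = \<chi> ?a" by (simp only: ab \<phi>.const smult_1)
    finally show ?thesis .
  qed
  have pow: "\<phi> (fls_monom 1 n, 0) = \<chi> (fls_monom 1 n, 0)" for n
    using nonneg[of "nat n"] neg[of "nat (- n)"] by (cases "0 \<le> n") simp_all
  have monom: "\<phi> (fls_monom c n, 0) = \<chi> (fls_monom c n, 0)" for c n
  proof -
    have c: "(fls_monom c n, 0) = smult R0 R1 (sconst c) (fls_monom 1 n, 0)"
      by (simp add: sconst_def smult_even fls_const_conv_monom)
    show ?thesis unfolding c \<phi>.mult \<chi>.mult \<phi>.const \<chi>.const pow ..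
  qed
  have "fst (\<phi> (f, 0)) = fst (\<chi> (f, 0))" "snd (\<phi> (f, 0)) = snd (\<chi> (f, 0))" for f
    by (rule fls_contadd_eqI[OF \<phi>.fls_contadd_restrict(1) \<chi>.fls_contadd_restrict(1)],
        simp only: monom,
        rule fls_contadd_eqI[OF \<phi>.fls_contadd_restrict(2) \<chi>.fls_contadd_restrict(2)],
        simp only: monom)
  then have even: "\<phi> (f, 0) = \<chi> (f, 0)" for f by (simp add: prod_eq_iff)
  have "\<phi> (f, g) = \<chi> (f, g)" for f g
  proof -
    have "(f, g) = sadd (f, 0) (smult R0 R1 szeta (g, 0))" by (simp add: smult_szeta sadd_def)
    then show ?thesis by (simp only: \<phi>.add \<chi>.add \<phi>.mult \<chi>.mult even zeta)
  qed
  then show "\<phi> = \<chi>" by auto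
qed

lemma (in supercommutative_ring) psi_bij: "bij_betw psi (SWitt R0 R1) (GammaT R0 R1)"
proof (rule bij_betw_imageI[OF psi_inj])
  have "psi \<phi> \<in> GammaT R0 R1" if "\<phi> \<in> SWitt R0 R1" for \<phi>
    by (rule superconformal_automorphism.psi_in_GammaT) (unfold_locales, rule that)
  then show "psi ` SWitt R0 R1 = GammaT R0 R1" using psi_surj by blast
qed

text \<open>\<open>psi\<close> only evaluates at z and \<zeta>, which every coefficient map
  \<open>smap h\<close> fixes.\<close>

lemma psi_natural:
  assumes h: "superring_hom R0 R1 R0' R1' h" and eq: "\<And>x. \<phi>' (smap h x) = smap h (\<phi> x)"
  shows "psi \<phi>' = tmap h (psi \<phi>)"
proof -
  have "h (0 + 0) = h 0 + h 0" and h1: "h 1 = 1" using h unfolding superring_hom_def by blast+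
  then have h0: "h 0 = 0" by simp
  have "smap h sz = sz" "smap h szeta = szeta"
    by (auto simp: smap_def sz_def szeta_def fls_eq_iff fls_map_nth h0 h1)
  then show ?thesis using eq[of sz] eq[of szeta] by (simp add: psi_def tmap_def smap_def)
qed

theorem mainTheorem14:
  fixes R0 R1 :: "'a::ring_1 set"
  assumes "superring R0 R1"
  shows "bij_betw psi (SWitt R0 R1) (GammaT R0 R1) \<and>
    (\<forall>(R0'::'b::ring_1 set) R1' h. superring R0' R1' \<and> superring_hom R0 R1 R0' R1' h \<longrightarrow>
       (\<forall>\<phi>\<in>SWitt R0 R1. \<forall>\<phi>'\<in>SWitt R0' R1'.
          (\<forall>x. \<phi>' (smap h x) = smap h (\<phi> x)) \<longrightarrow> psi \<phi>' = tmap h (psi \<phi>)))"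
proof (intro conjI allI impI ballI)
  interpret supercommutative_ring R0 R1 by unfold_locales (rule assms)
  show "bij_betw psi (SWitt R0 R1) (GammaT R0 R1)" by (rule psi_bij)
qed (blast intro: psi_natural)

end
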